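(* Let $\bar n>0$ be an integer, let $\mathcal{H}_{\bar n}=\mathrm{span}\{|0\rangle,|1\rangle,\dots,|\bar n\rangle\}$, and let $\mathbf{P}_{\bar n}$ be the orthogonal projection onto $\mathcal{H}_{\bar n}$. Let $\mathbf{N}_{\bar n}=\mathbf{P}_{\bar n}\mathbf{N}\mathbf{P}_{\bar n}$ and $\mathbf{a}_{\bar n}=\mathbf{P}_{\bar n}\mathbf{a}\mathbf{P}_{\bar n}$ be the truncations to $\mathcal{H}_{\bar n}$ of the photon-number operator $\mathbf{N}$ and the annihilation operator $\mathbf{a}$. Let $\beta\in\mathbb{R}$, $\kappa>0$, $\kappa_c\ge 0$, and consider the differential equation $$\tfrac{d}{dt}\bar\rho_{\bar n}=\beta[\mathbf{a}_{\bar n}^\dagger-\mathbf{a}_{\bar n},\bar\rho_{\bar n}]-\tfrac{\kappa+\kappa_c}{2}\left(\mathbf{N}_{\bar n}\bar\rho_{\bar n}+\bar\rho_{\bar n}\mathbf{N}_{\bar n}-2\mathbf{a}_{\bar n}\bar\rho_{\bar n}\mathbf{a}_{\bar n}^\dagger\right)-\kappa_c\left(\mathbf{a}_{\bar n}\bar\rho_{\bar n}\mathbf{a}_{\bar n}^\dagger-e^{i\pi\mathbf{N}_{\bar n}}\mathbf{a}_{\bar n}\bar\rho_{\bar n}\mathbf{a}_{\bar n}^\dagger e^{-i\pi\mathbf{N}_{\bar n}}\right)$$ for density operators $\bar\rho_{\bar n}$ whose support is included in $\mathcal{H}_{\bar n}$. If this equation admits a full-rank steady state $\bar\rho_{\bar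 n,\infty}$ (full rank on $\mathcal{H}_{\bar n}$), then the Lyapunov function $V_{\mathrm{Bures}}(\bar\rho_{\bar n})=\mathrm{Tr}(\bar\rho_{\bar n,\infty}G^2)$, where $G$ is the solution on $\mathcal{H}_{\bar n}$ of $\bar\rho_{\bar n,\infty}G+G\bar\rho_{\bar n,\infty}=\bar\rho_{\bar n}-\bar\rho_{\bar n,\infty}$, is strict for this equation, and the system globally converges towards $\bar\rho_{\bar n,\infty}$, i.e. every solution starting from a density operator supported in $\mathcal{H}_{\bar n}$ tends to $\bar\rho_{\bar n,\infty}$ as $t\to+\infty$.
   Context: The Hilbert space of the harmonic oscillator has orthonormal (Fock) basis $|n\rangle$, $n=0,1,2,\dots$; $\mathbf{N}=\sum_{n\ge0}n|n\rangle\langle n|$ and $\mathbf{a}=\sum_{n\ge1}\sqrt n\,|n-1\rangle\langle n|$, so that $\mathbf{a}^\dagger\mathbf{a}=\mathbf{N}$. A density operator is a self-adjoint, positive semi-definite operator of trace one; $[A,B]=AB-BA$ and ${}^\dagger$ is the operator adjoint. Strict Lyapunov function means: $V_{\mathrm{Bures}}\ge 0$ with equality only at $\bar\rho_{\bar n,\infty}$, and along solutions $\tfrac{d}{dt}V_{\mathrm{Bures}}\le0$ with equality only when $\bar\rho_{\bar n}=\bar\rho_{\bar n,\infty}$. *)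

theory Defs
  imports Complex_Main "Jordan_Normal_Form.Schur_Decomposition" "Jordan_Normal_Form.DL_Rank"
begin

definition mat_trace :: "'a::comm_monoid_add mat \<Rightarrow> 'a" where
  "mat_trace A = (\<Sum>i<dim_row A. A $$ (i, i))"

definition commutator :: "'a::ring mat \<Rightarrow> 'a mat \<Rightarrow> 'a mat" where
  "commutator A B = A * B - B * A"

(* Matrices carry no topology, so the exponential series is summed entry by entry. *)
definition mat_exp :: "complex mat \<Rightarrow> complex mat" where
  "mat_exp A = mat (dim_row A) (dim_col A) (\<lambda>(i, j). \<Sum>k. (A ^\<^sub>m k) $$ (i, j) / fact k)"

(* The order on complex numbers is the partial one: 0 <= z says that z is real and nonnegative. *)
definition density_operators :: "nat \<Rightarrow> complex mat set" where
  "density_operators d = {\<rho> \<in> carrier_mat d d.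
     mat_adjoint \<rho> = \<rho> \<and> (\<forall>v \<in> carrier_vec d. 0 \<le> (\<rho> *\<^sub>v v) \<bullet>c v) \<and> mat_trace \<rho> = 1}"

(* Operators on the oscillator space are given by their matrix elements <i|A|j> in the
   Fock basis, i and j ranging over all natural numbers. *)
definition fock_N :: "nat \<Rightarrow> nat \<Rightarrow> complex" where
  "fock_N i j = (if i = j then of_nat j else 0)"

definition fock_a :: "nat \<Rightarrow> nat \<Rightarrow> complex" where
  "fock_a i j = (if j = i + 1 then complex_of_real (sqrt (real j)) else 0)"

(* The restriction of P A P to the range of P, the span of |0>, ..., |n>: the compression of A
   to a subspace of dimension n + 1. *)
definition truncate :: "nat \<Rightarrow> (nat \<Rightarrow> nat \<Rightarrow> complex) \<Rightarrow> complex mat" where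
  "truncate n A = mat (n + 1) (n + 1) (\<lambda>(i, j). A i j)"

definition master_rhs :: "nat \<Rightarrow> real \<Rightarrow> real \<Rightarrow> real \<Rightarrow> complex mat \<Rightarrow> complex mat" where
  "master_rhs n \<beta> \<kappa> \<kappa>\<^sub>c \<rho> =
    (let N = truncate n fock_N;
         a = truncate n fock_a;
         a' = mat_adjoint a;
         E = mat_exp ((\<i> * complex_of_real pi) \<cdot>\<^sub>m N);
         E' = mat_exp ((- \<i> * complex_of_real pi) \<cdot>\<^sub>m N)
     in complex_of_real \<beta> \<cdot>\<^sub>m commutator (a' - a) \<rho>
        - complex_of_real ((\<kappa> + \<kappa>\<^sub>c) / 2) \<cdot>\<^sub>m (N * \<rho> + \<rho> * N - 2 \<cdot>\<^sub>m (a * \<rho> * a'))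
        - complex_of_real \<kappa>\<^sub>c \<cdot>\<^sub>m (a * \<rho> * a' - E * a * \<rho> * a' * E'))"

(* Forward solutions, differentiated entry by entry; only the initial value is required
   to be a density operator. *)
definition master_solution ::
    "nat \<Rightarrow> real \<Rightarrow> real \<Rightarrow> real \<Rightarrow> (real \<Rightarrow> complex mat) \<Rightarrow> bool" where
  "master_solution n \<beta> \<kappa> \<kappa>\<^sub>c \<rho> \<longleftrightarrow>
     \<rho> 0 \<in> density_operators (n + 1) \<and>
     (\<forall>t\<ge>0. \<rho> t \<in> carrier_mat (n + 1) (n + 1) \<and>
       (\<forall>i\<le>n. \<forall>j\<le>n. ((\<lambda>s. \<rho> s $$ (i, j)) has_vector_derivative
          master_rhs n \<beta> \<kappa> \<kappa>\<^sub>c (\<rho> t) $$ (i, j)) (at t within {0..})))"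

definition full_rank_steady_state ::
    "nat \<Rightarrow> real \<Rightarrow> real \<Rightarrow> real \<Rightarrow> complex mat \<Rightarrow> bool" where
  "full_rank_steady_state n \<beta> \<kappa> \<kappa>\<^sub>c \<sigma> \<longleftrightarrow>
     \<sigma> \<in> density_operators (n + 1) \<and> vec_space.rank (n + 1) \<sigma> = n + 1 \<and>
     master_rhs n \<beta> \<kappa> \<kappa>\<^sub>c \<sigma> = 0\<^sub>m (n + 1) (n + 1)"

definition bures_G :: "complex mat \<Rightarrow> complex mat \<Rightarrow> complex mat" where
  "bures_G \<sigma> \<rho> = (THE G. G \<in> carrier_mat (dim_row \<sigma>) (dim_row \<sigma>) \<and> \<sigma> * G + G * \<sigma> = \<rho> - \<sigma>)"

(* The trace is real whenever \<sigma> and G are self-adjoint, since then it equals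
   the trace of G * \<sigma> * G. *)
definition V_Bures :: "complex mat \<Rightarrow> complex mat \<Rightarrow> real" where
  "V_Bures \<sigma> \<rho> = Re (mat_trace (\<sigma> * (bures_G \<sigma> \<rho> * bures_G \<sigma> \<rho>)))"

(* X is the state space, sol the set of solutions on the half-line of nonnegative times.
   At t = 0 the derivative along a solution is one-sided. *)
definition strict_lyapunov ::
    "'s set \<Rightarrow> ((real \<Rightarrow> 's) \<Rightarrow> bool) \<Rightarrow> ('s \<Rightarrow> real) \<Rightarrow> 's \<Rightarrow> bool" where
  "strict_lyapunov X sol V \<xi> \<longleftrightarrow>
     (\<forall>x\<in>X. 0 \<le> V x \<and> (V x = 0 \<longleftrightarrow> x = \<xi>)) \<and>
     (\<forall>x. sol x \<longrightarrow> (\<forall>t\<ge>0. \<exists>D.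
        ((\<lambda>s. V (x s)) has_real_derivative D) (at t within {0..}) \<and>
        D \<le> 0 \<and> (D = 0 \<longleftrightarrow> x t = \<xi>)))"

end

theory Submission
  imports Defs "HOL-Analysis.Function_Topology"
begin

text \<open>
  The equation is a Lindblad equation with Hamiltonian part \<open>[A, _]\<close> and jump operators \<open>a\<close> and
  \<open>E a\<close>. With \<open>\<sigma> G + G \<sigma> = \<rho> - \<sigma>\<close> and stationarity of \<open>\<sigma>\<close>, cyclicity of the trace gives
  \<open>dV/dt = - \<Sum>\<^sub>L Tr (\<sigma> [L, G]\<^sup>* [L, G])\<close>, the sum being over the jump operators. If this vanishes,
  the self-adjoint \<open>G\<close> commutes with \<open>a\<close>, hence is scalar, and \<open>Tr \<rho> = 1\<close> forces \<open>G = 0\<close>. Dissipation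
  and \<open>V\<close> are quadratic in \<open>G\<close>, so by compactness of the unit sphere the former dominates
  a multiple of the latter and \<open>V\<close> decays exponentially. Only the initial value of a solution is assumed
  to be self-adjoint; the same decay applied to \<open>\<i> (\<rho> - \<rho>\<^sup>*)\<close>, which starts at \<open>0\<close>, shows that
  self-adjointness persists.
\<close>

section \<open>Trace, adjoint and Lindblad generators\<close>

text \<open>The dissipation formula is a carre du champ identity: if \<open>D\<close> is the trace
  dual of the dissipator of \<open>L\<close>, then \<open>D (G G) - D G G - G D G\<close> is the
  adjoint of \<open>[L, G]\<close> times \<open>[L, G]\<close>, while a commutator part is a
  derivation and leaves no such defect. Traced against \<open>\<sigma>\<close>, the first term
  vanishes by stationarity of the whole generator, and the equation for \<open>G\<close> identifies
  the other two with minus the derivative of \<open>V\<close>. Full rank enters through positive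
  definiteness of \<open>\<sigma>\<close>, which makes the equation for \<open>G\<close> uniquely
  solvable and the trace forms definite. As \<open>\<kappa>\<^sub>c\<close> may be 0,
  \<open>a\<close> alone has to force \<open>G\<close> to be scalar: being a weighted shift, it
  makes \<open>G\<close> upper triangular with constant diagonal. A derivative that is negative away
  from \<open>\<sigma>\<close> does not by itself give convergence. Comparing two quadratic forms
  takes the place of an invariance argument. Scalars are in the kernel of the dissipation, so the
  comparison is confined to the hyperplane \<open>Tr (\<sigma> G) = 0\<close>, where the solutions
  for traceless right-hand sides lie.\<close>

lemmas square_mat_simps =
  mult_carrier_mat[of _ d d _ d] add_carrier_mat[of _ d d] minus_carrier_mat[of _ d d]
  assoc_mult_mat[of _ d d _ d _ d]
  add_mult_distrib_mat[of _ d d _ _ d] mult_add_distrib_mat[of _ d d _ d]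
  minus_mult_distrib_mat[of _ d d _ _ d] mult_minus_distrib_mat[of _ d d _ d]
  mult_smult_assoc_mat[of _ d d _ d] mult_smult_distrib[of _ d d _ d] for d

lemma mat_trace_add:
  "A \<in> carrier_mat d d \<Longrightarrow> B \<in> carrier_mat d d \<Longrightarrow> mat_trace (A + B) = mat_trace A + mat_trace B"
  unfolding mat_trace_def by (simp add: sum.distrib)

lemma mat_trace_minus:
  fixes A :: "'a::ab_group_add mat"
  shows "A \<in> carrier_mat d d \<Longrightarrow> B \<in> carrier_mat d d \<Longrightarrow> mat_trace (A - B) = mat_trace A - mat_trace B"
  unfolding mat_trace_def by (simp add: sum_subtractf)

lemma mat_trace_smult:
  fixes A :: "'a::semiring_0 mat"
  shows "A \<in> carrier_mat d d \<Longrightarrow> mat_trace (c \<cdot>\<^sub>m A) = c * mat_trace A"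
  unfolding mat_trace_def by (simp add: sum_distrib_left)

lemma index_mult_mat_sum:
  "A \<in> carrier_mat n m \<Longrightarrow> B \<in> carrier_mat m k \<Longrightarrow> i < n \<Longrightarrow> j < k \<Longrightarrow>
   (A * B) $$ (i, j) = (\<Sum>l<m. A $$ (i, l) * B $$ (l, j))"
  by (auto simp: scalar_prod_def atLeast0LessThan)

lemma mat_trace_comm:
  fixes A :: "'a::comm_semiring_0 mat"
  assumes "A \<in> carrier_mat n m" "B \<in> carrier_mat m n"
  shows "mat_trace (A * B) = mat_trace (B * A)"
proof -
  have "mat_trace (A * B) = (\<Sum>i<n. \<Sum>l<m. A $$ (i, l) * B $$ (l, i))"
    using assms unfolding mat_trace_def by (auto simp del: index_mult_mat(1) simp: index_mult_mat_sum[of _ n m _ n])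
  also have "\<dots> = (\<Sum>l<m. \<Sum>i<n. B $$ (l, i) * A $$ (i, l))"
    by (subst sum.swap) (simp add: mult.commute)
  also have "\<dots> = mat_trace (B * A)"
    using assms unfolding mat_trace_def by (auto simp del: index_mult_mat(1) simp: index_mult_mat_sum[of _ m n _ m])
  finally show ?thesis .
qed

text \<open>Traces of right-nested words are normalised by bringing the letter \<open>S\<close> to the front.\<close>

lemma mat_trace_rotate:
  fixes S :: "'a::comm_semiring_0 mat"
  assumes "S \<in> carrier_mat d d" "A \<in> carrier_mat d d"
  shows "mat_trace (A * S) = mat_trace (S * A)"
    and "B \<in> carrier_mat d d \<Longrightarrow> mat_trace (A * (S * B)) = mat_trace (S * (B * A))"
    and "B \<in> carrier_mat d d \<Longrightarrow> mat_trace (A * (B * S)) = mat_trace (S * (A * B))"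
    and "B \<in> carrier_mat d d \<Longrightarrow> C \<in> carrier_mat d d \<Longrightarrow>
      mat_trace (A * (B * (S * C))) = mat_trace (S * (C * (A * B)))"
    and "B \<in> carrier_mat d d \<Longrightarrow> C \<in> carrier_mat d d \<Longrightarrow>
      mat_trace (A * (B * (C * S))) = mat_trace (S * (A * (B * C)))"
    and "B \<in> carrier_mat d d \<Longrightarrow> C \<in> carrier_mat d d \<Longrightarrow> D \<in> carrier_mat d d \<Longrightarrow>
      mat_trace (A * (B * (C * (S * D)))) = mat_trace (S * (D * (A * (B * C))))"
    and "B \<in> carrier_mat d d \<Longrightarrow> C \<in> carrier_mat d d \<Longrightarrow> D \<in> carrier_mat d d \<Longrightarrow>
      mat_trace (A * (B * (C * (D * S)))) = mat_trace (S * (A * (B * (C * D))))"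
  using assms mat_trace_comm[of A d d S] mat_trace_comm[of A d d "S * B"]
    mat_trace_comm[of "A * B" d d S] mat_trace_comm[of "A * B" d d "S * C"]
    mat_trace_comm[of "A * (B * C)" d d S] mat_trace_comm[of "A * (B * C)" d d "S * D"]
    mat_trace_comm[of "A * (B * (C * D))" d d S]
  by (auto simp: square_mat_simps[where d = d])

section \<open>Adjoint matrices\<close>

lemma dim_mat_adjoint [simp]: "dim_row (mat_adjoint A) = dim_col A" "dim_col (mat_adjoint A) = dim_row A"
  unfolding mat_adjoint_def by auto

lemma mat_adjoint_carrier [simp]: "A \<in> carrier_mat n m \<Longrightarrow> mat_adjoint A \<in> carrier_mat m n"
  unfolding carrier_mat_def by auto

lemma index_mat_adjoint:
  "i < dim_col A \<Longrightarrow> j < dim_row A \<Longrightarrow> mat_adjoint A $$ (i, j) = conjugate (A $$ (j, i))"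
  unfolding mat_adjoint_def by (simp add: mat_of_rows_index)

lemma mat_adjoint_adjoint [simp]: "mat_adjoint (mat_adjoint A) = A"
  by (rule eq_matI) (auto simp: index_mat_adjoint)

lemma mat_adjoint_mult:
  assumes "A \<in> carrier_mat n m" "B \<in> carrier_mat m k"
  shows "mat_adjoint (A * B) = mat_adjoint B * mat_adjoint A"
  by (rule eq_matI)
    (use assms in \<open>auto simp: index_mat_adjoint scalar_prod_def sum_conjugate conjugate_dist_mul
      mult.commute intro!: sum.cong\<close>)

lemma mat_adjoint_add:
  "A \<in> carrier_mat n m \<Longrightarrow> B \<in> carrier_mat n m \<Longrightarrow> mat_adjoint (A + B) = mat_adjoint A + mat_adjoint B"
  by (rule eq_matI) (auto simp: index_mat_adjoint conjugate_dist_add)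

lemma mat_adjoint_minus:
  fixes A :: "complex mat"
  shows "A \<in> carrier_mat n m \<Longrightarrow> B \<in> carrier_mat n m \<Longrightarrow> mat_adjoint (A - B) = mat_adjoint A - mat_adjoint B"
  by (rule eq_matI) (auto simp: index_mat_adjoint)

lemma mat_adjoint_smult:
  fixes A :: "complex mat"
  shows "mat_adjoint (c \<cdot>\<^sub>m A) = cnj c \<cdot>\<^sub>m mat_adjoint A"
  by (rule eq_matI) (auto simp: index_mat_adjoint)

lemmas mat_adjoint_simps = mat_adjoint_mult[of _ d d _ d] mat_adjoint_add[of _ d d]
  mat_adjoint_minus[of _ d d] for d

section \<open>Commutators, dissipators and their trace identities\<close>

lemma commutator_carrier [simp]:
  "A \<in> carrier_mat d d \<Longrightarrow> B \<in> carrier_mat d d \<Longrightarrow> commutator A B \<in> carrier_mat d d"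
  unfolding commutator_def by auto

definition dissipator :: "complex mat \<Rightarrow> complex mat \<Rightarrow> complex mat" where
  "dissipator L X = L * X * mat_adjoint L
     - (1 / 2) \<cdot>\<^sub>m (mat_adjoint L * L * X + X * (mat_adjoint L * L))"

lemma dissipator_carrier [simp]:
  "L \<in> carrier_mat d d \<Longrightarrow> X \<in> carrier_mat d d \<Longrightarrow> dissipator L X \<in> carrier_mat d d"
  unfolding dissipator_def by (intro minus_carrier_mat smult_carrier_mat add_carrier_mat mult_carrier_mat[of _ d d]) auto

text \<open>The mixed words \<open>G A G S\<close> and \<open>G S G A\<close> have equal traces and
  cancel; in the surviving words the two letters \<open>G\<close> are cyclically adjacent.\<close>

lemma trace_commutator_anticommutator:
  fixes A S G :: "complex mat"
  assumes "A \<in> carrier_mat d d" "S \<in> carrier_mat d d" "G \<in> carrier_mat d d"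
  shows "mat_trace (G * commutator A (S * G + G * S)) = mat_trace (commutator A S * (G * G))"
  unfolding commutator_def using assms
  by (simp add: square_mat_simps[where d = d] mat_trace_add[of _ d] mat_trace_minus[of _ d]
      mat_trace_rotate[of S d])

text \<open>With \<open>L'\<close> the adjoint of \<open>L\<close> and
  \<open>D X = L' X L - (L' L X + X L' L) / 2\<close>, this is the identity
  \<open>D (G G) - D G G - G D G = [G, L'] [L, G]\<close> traced against \<open>S\<close>.
  Self-adjointness of \<open>G\<close> makes \<open>[G, L']\<close> the adjoint of
  \<open>[L, G]\<close>.\<close>

lemma trace_dissipator_anticommutator:
  fixes L S G :: "complex mat"
  assumes L: "L \<in> carrier_mat d d" and S: "S \<in> carrier_mat d d" and G: "G \<in> carrier_mat d d"
    and "mat_adjoint G = G"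
  shows "mat_trace (G * dissipator L (S * G + G * S)) =
    mat_trace (dissipator L S * (G * G)) - mat_trace (S * (mat_adjoint (commutator L G) * commutator L G))"
proof -
  define L' where "L' = mat_adjoint L"
  have L': "L' \<in> carrier_mat d d" using L by (simp add: L'_def)
  show ?thesis
    unfolding commutator_def dissipator_def mat_adjoint_minus[OF mult_carrier_mat[OF L G] mult_carrier_mat[OF G L]]
      mat_adjoint_mult[OF L G] mat_adjoint_mult[OF G L] \<open>mat_adjoint G = G\<close> L'_def[symmetric]
    using assms(1-3) L'
    by (simp add: square_mat_simps[where d = d] mat_trace_add[of _ d] mat_trace_minus[of _ d]
        mat_trace_smult[of _ d] mat_trace_rotate[of S d] algebra_simps)
qed

lemma mat_trace_commutator:
  fixes A B :: "complex mat"
  assumes "A \<in> carrier_mat d d" "B \<in> carrier_mat d d"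
  shows "mat_trace (commutator A B) = 0"
  unfolding commutator_def using assms
  by (simp add: mat_trace_minus[of _ d] mat_trace_comm[of B d d A])

lemma mat_trace_dissipator:
  assumes "L \<in> carrier_mat d d" "X \<in> carrier_mat d d"
  shows "mat_trace (dissipator L X) = 0"
  unfolding dissipator_def using assms
  by (simp add: square_mat_simps[where d = d] mat_trace_add[of _ d] mat_trace_minus[of _ d]
        mat_trace_smult[of _ d] mat_trace_rotate[of X d])

section \<open>Positive definite matrices and the Sylvester equation\<close>

definition positive_definite :: "nat \<Rightarrow> complex mat \<Rightarrow> bool" where
  "positive_definite d S \<longleftrightarrow> S \<in> carrier_mat d d \<and> mat_adjoint S = S \<and>
     (\<forall>v \<in> carrier_vec d. 0 \<le> (S *\<^sub>v v) \<bullet>c v \<and> ((S *\<^sub>v v) \<bullet>c v = 0 \<longrightarrow> v = 0\<^sub>v d))"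

lemma adjoint_cscalar_prod:
  fixes A :: "complex mat"
  assumes "A \<in> carrier_mat n m" "u \<in> carrier_vec n" "v \<in> carrier_vec m"
  shows "u \<bullet>c (A *\<^sub>v v) = (mat_adjoint A *\<^sub>v u) \<bullet>c v"
proof -
  have "u \<bullet>c (A *\<^sub>v v) = (\<Sum>i<n. \<Sum>j<m. u $ i * cnj (A $$ (i, j)) * cnj (v $ j))"
    using assms by (auto simp: scalar_prod_def atLeast0LessThan sum_distrib_left mult.assoc intro!: sum.cong)
  also have "\<dots> = (\<Sum>j<m. \<Sum>i<n. u $ i * cnj (A $$ (i, j)) * cnj (v $ j))"
    by (rule sum.swap)
  also have "\<dots> = (mat_adjoint A *\<^sub>v u) \<bullet>c v"
    using assms
    by (auto simp: scalar_prod_def atLeast0LessThan index_mat_adjoint sum_distrib_left mult_ac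
        intro!: sum.cong)
  finally show ?thesis .
qed

text \<open>A vector on which a nonnegative form vanishes lies in the kernel of its matrix, as in
  the Cauchy-Schwarz inequality; a nonzero determinant leaves only the zero vector.\<close>

lemma positive_definiteI:
  fixes S :: "complex mat"
  assumes S: "S \<in> carrier_mat d d" and herm: "mat_adjoint S = S"
    and pos: "\<And>v. v \<in> carrier_vec d \<Longrightarrow> 0 \<le> (S *\<^sub>v v) \<bullet>c v"
    and det: "det S \<noteq> 0"
  shows "positive_definite d S"
  unfolding positive_definite_def
proof (intro conjI ballI impI S herm pos)
  fix v :: "complex vec" assume v: "v \<in> carrier_vec d" and zero: "(S *\<^sub>v v) \<bullet>c v = 0"
  define w where "w = S *\<^sub>v v"
  have w: "w \<in> carrier_vec d" using S v by (simp add: w_def)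
  define p where "p = w \<bullet>c w"
  define q where "q = (S *\<^sub>v w) \<bullet>c w"
  have p: "0 \<le> p" unfolding p_def by (rule conjugate_square_ge_0_vec)
  have q: "0 \<le> q" unfolding q_def by (rule pos[OF w])
  \<comment> \<open>The form at \<open>v - s S v\<close> is \<open>s\<^sup>2 q - 2 s p\<close>, negative for small \<open>s > 0\<close> unless \<open>p = 0\<close>.\<close>
  have "p = 0"
  proof -
    \<comment> \<open>The summand 1 keeps the denominator positive when \<open>q = 0\<close>. This
      \<open>s\<close> satisfies \<open>s * Re q \<le> Re p\<close>, so
      \<open>s * Re q - 2 * Re p\<close> is negative as soon as \<open>Re p\<close> is
      positive.\<close>
    define s where "s = Re p / (1 + Re q)"
    define c where "c = complex_of_real s"
    define u where "u = v - c \<cdot>\<^sub>v w"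
    have u: "u \<in> carrier_vec d" using v w by (simp add: u_def)
    have Su: "S *\<^sub>v u = w - c \<cdot>\<^sub>v (S *\<^sub>v w)"
      unfolding u_def w_def using S v w[unfolded w_def]
      by (simp add: mult_minus_distrib_mat_vec[of _ d d] mult_mat_vec[of _ d d])
    have Sw: "S *\<^sub>v w \<in> carrier_vec d" using S w by simp
    have 1: "w \<bullet>c v = 0" using zero by (simp add: w_def)
    have 2: "(S *\<^sub>v w) \<bullet>c v = p"
      using adjoint_cscalar_prod[OF S w v] herm by (simp add: p_def w_def)
    have cu: "conjugate u = conjugate v - c \<cdot>\<^sub>v conjugate w"
      unfolding u_def c_def using v w by (intro eq_vecI) auto
    have "(S *\<^sub>v u) \<bullet>c u = (w \<bullet>c v - c * (w \<bullet>c w)) - c * ((S *\<^sub>v w) \<bullet>c v - c * ((S *\<^sub>v w) \<bullet>c w))"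
      unfolding Su cu using v w Sw
      by (simp add: minus_scalar_prod_distrib[of _ d] scalar_prod_minus_distrib[of _ d]
          scalar_prod_smult_distrib[of _ d] smult_scalar_prod_distrib[of _ d] algebra_simps)
    also have "\<dots> = c * c * q - 2 * c * p" using 1 2 by (simp add: p_def q_def algebra_simps)
    finally have "0 \<le> Re (c * c * q - 2 * c * p)" using pos[OF u] by (auto simp: less_eq_complex_def)
    hence nonneg: "0 \<le> s * (s * Re q - 2 * Re p)" by (simp add: c_def algebra_simps)
    have "0 \<le> Re q" and "0 \<le> Re p" and "Im p = 0" using p q by (auto simp: less_eq_complex_def)
    have "\<not> 0 < Re p"
    proof
      assume "0 < Re p"
      hence "0 < s" and "s * Re q \<le> Re p"
        using \<open>0 \<le> Re q\<close> by (auto simp: s_def field_simps)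
      thus False using nonneg \<open>0 < Re p\<close> by (simp add: zero_le_mult_iff)
    qed
    thus "p = 0" using \<open>0 \<le> Re p\<close> \<open>Im p = 0\<close> by (simp add: complex_eq_iff)
  qed
  hence "w = 0\<^sub>v d" using w unfolding p_def by (simp add: conjugate_square_eq_0_vec[of _ d])
  thus "v = 0\<^sub>v d" using det_0_iff_vec_prod_zero_field[OF S] det v by (auto simp: w_def)
qed

text \<open>Rotating \<open>M\<close> to the front puts values of the form of \<open>S\<close>, at
  the conjugated rows of \<open>M\<close>, on the diagonal. Both sign and definiteness of the trace
  are read off from this sum.\<close>

lemma trace_sandwich:
  fixes S M :: "complex mat"
  assumes S: "S \<in> carrier_mat d d" and M: "M \<in> carrier_mat d d"
  shows "mat_trace (S * (mat_adjoint M * M)) =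
    (\<Sum>i<d. (S *\<^sub>v col (mat_adjoint M) i) \<bullet>c col (mat_adjoint M) i)"
proof -
  have "mat_trace (S * (mat_adjoint M * M)) = mat_trace (M * (S * mat_adjoint M))"
    using S M by (simp add: mat_trace_rotate[of S d])
  also have "\<dots> = (\<Sum>i<d. (S *\<^sub>v col (mat_adjoint M) i) \<bullet>c col (mat_adjoint M) i)"
  proof -
    have "(M * (S * mat_adjoint M)) $$ (i, i) = (S *\<^sub>v col (mat_adjoint M) i) \<bullet>c col (mat_adjoint M) i"
      if i: "i < d" for i
    proof -
      have "conjugate (col (mat_adjoint M) i) = row M i"
        using M i by (intro eq_vecI) (auto simp: index_mat_adjoint)
      moreover have "col (S * mat_adjoint M) i = S *\<^sub>v col (mat_adjoint M) i"
        using S M i by (intro eq_vecI) auto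
      moreover have "row M i \<bullet> (S *\<^sub>v col (mat_adjoint M) i) = (S *\<^sub>v col (mat_adjoint M) i) \<bullet> row M i"
        using S M i by (intro comm_scalar_prod[of _ d]) (auto simp: mult_mat_vec_def intro!: carrier_vecI)
      ultimately show ?thesis using S M i by simp
    qed
    thus ?thesis unfolding mat_trace_def using S M by simp
  qed
  finally show ?thesis .
qed

lemma trace_sandwich_nonneg:
  assumes "positive_definite d S" "M \<in> carrier_mat d d"
  shows "0 \<le> mat_trace (S * (mat_adjoint M * M))"
  using assms trace_sandwich[of S d M] unfolding positive_definite_def
  by (auto intro!: sum_nonneg simp del: conjugate_vec_def)

lemma trace_sandwich_eq_0:
  assumes S: "positive_definite d S" and M: "M \<in> carrier_mat d d"
    and zero: "mat_trace (S * (mat_adjoint M * M)) = 0"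
  shows "M = 0\<^sub>m d d"
proof -
  have *: "S \<in> carrier_mat d d" using S by (simp add: positive_definite_def)
  have c: "col (mat_adjoint M) i \<in> carrier_vec d" for i
    using M by (auto simp: col_def)
  have "\<forall>i\<in>{..<d}. (S *\<^sub>v col (mat_adjoint M) i) \<bullet>c col (mat_adjoint M) i = 0"
    using zero S c unfolding trace_sandwich[OF * M] positive_definite_def
    by (subst (asm) sum_nonneg_eq_0_iff) auto
  hence z: "col (mat_adjoint M) i = 0\<^sub>v d" if "i < d" for i
    using S c that unfolding positive_definite_def by auto
  show ?thesis
  proof (rule eq_matI)
    fix i j assume ij: "i < dim_row (0\<^sub>m d d :: complex mat)" "j < dim_col (0\<^sub>m d d :: complex mat)"
    have "col (mat_adjoint M) i $ j = 0" using z ij by simp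
    thus "M $$ (i, j) = 0\<^sub>m d d $$ (i, j)" using ij M by (simp add: index_mat_adjoint)
  qed (use M in auto)
qed

text \<open>Pairing the equation with the adjoint \<open>G'\<close> of \<open>G\<close> gives
  \<open>Tr (S G G') + Tr (S G' G) = 0\<close>, a sum of two nonnegative terms. \<open>G\<close> is
  arbitrary here because injectivity on all matrices is what makes the linear system below
  invertible.\<close>

lemma sylvester_unique_0:
  assumes S: "positive_definite d S" and G: "G \<in> carrier_mat d d"
    and eq: "S * G + G * S = 0\<^sub>m d d"
  shows "G = 0\<^sub>m d d"
proof -
  have *: "S \<in> carrier_mat d d" using S by (simp add: positive_definite_def)
  let ?G = "mat_adjoint G"
  have G': "?G \<in> carrier_mat d d" using G by simp
  have "0 = mat_trace (?G * (S * G + G * S))"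
    unfolding eq using right_mult_zero_mat[OF G'] by (simp add: mat_trace_def)
  also have "\<dots> = mat_trace (S * (mat_adjoint ?G * ?G)) + mat_trace (S * (?G * G))"
    using * G G' by (simp add: square_mat_simps[where d = d] mat_trace_add[of _ d] mat_trace_rotate[of S d])
  finally have "mat_trace (S * (?G * G)) = 0"
    using trace_sandwich_nonneg[OF S G] trace_sandwich_nonneg[OF S G']
    by (metis add_nonneg_eq_0_iff)
  thus ?thesis by (rule trace_sandwich_eq_0[OF S G])
qed

lemma sylvester_unique:
  assumes S: "positive_definite d S" and G: "G \<in> carrier_mat d d" and H: "H \<in> carrier_mat d d"
    and eq: "S * G + G * S = S * H + H * S"
  shows "G = H"
proof -
  have *: "S \<in> carrier_mat d d" using S by (simp add: positive_definite_def)
  have "S * (G - H) + (G - H) * S = (S * G + G * S) - (S * H + H * S)"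
    using * G H by (intro eq_matI) (auto simp: square_mat_simps[where d = d] simp del: index_mult_mat(1))
  also have "\<dots> = 0\<^sub>m d d" unfolding eq using * H by (intro eq_matI) auto
  finally have zero: "G - H = 0\<^sub>m d d" by (rule sylvester_unique_0[OF S minus_carrier_mat[OF H]])
  show ?thesis
  proof (rule eq_matI)
    fix i j assume ij: "i < dim_row H" "j < dim_col H"
    have "(G - H) $$ (i, j) = 0" unfolding zero using ij H by simp
    thus "G $$ (i, j) = H $$ (i, j)" using ij G H by simp
  qed (use G H in auto)
qed

lemma sum_lessThan_mult:
  fixes f :: "nat \<Rightarrow> 'a::comm_monoid_add"
  shows "(\<Sum>q<m * d. f q) = (\<Sum>k<m. \<Sum>l<d. f (k * d + l))"
proof -
  have "(\<Sum>l<d. f (k * d + l)) = sum f {k * d..<k * d + d}" for k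
    by (rule sum.reindex_bij_witness[of _ "\<lambda>q. q - k * d" "\<lambda>l. k * d + l"]) auto
  thus ?thesis by (simp add: sum.nat_group[symmetric])
qed

text \<open>The map from \<open>G\<close> to \<open>S G + G S\<close> is linear and injective in
  finite dimension, hence invertible; \<open>B\<close> is its inverse in row-major coordinates. One
  \<open>B\<close> serves every \<open>X\<close>, so solutions depend on the entries of
  \<open>X\<close> with constant coefficients and can be differentiated in time.\<close>

lemma sylvester_solution:
  assumes S: "positive_definite d S"
  obtains B :: "complex mat" where
    "\<And>X. X \<in> carrier_mat d d \<Longrightarrow>
      S * mat d d (\<lambda>(i, j). \<Sum>p<d * d. B $$ (i * d + j, p) * X $$ (p div d, p mod d)) +
      mat d d (\<lambda>(i, j). \<Sum>p<d * d. B $$ (i * d + j, p) * X $$ (p div d, p mod d)) * S = X"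
proof -
  have Sc: "S \<in> carrier_mat d d" using S by (simp add: positive_definite_def)
  have lt: "i * d + j < d * d" if "i < d" "j < d" for i j
  proof -
    have "i * d + j < (i + 1) * d" using that by simp
    also have "\<dots> \<le> d * d" using that by (intro mult_right_mono) auto
    finally show ?thesis .
  qed
  \<comment> \<open>The Kronecker sum of \<open>S\<close> and its transpose, with \<open>p\<close>
    coding \<open>(i, j)\<close> and \<open>q\<close> coding \<open>(k, l)\<close>.\<close>
  define M where "M = mat (d * d) (d * d) (\<lambda>(p, q).
    (if q mod d = p mod d then S $$ (p div d, q div d) else 0) +
    (if q div d = p div d then S $$ (q mod d, p mod d) else 0))"
  have M: "M \<in> carrier_mat (d * d) (d * d)" by (simp add: M_def)
  have act: "(M *\<^sub>v v) $ (i * d + j) =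
      (S * mat d d (\<lambda>(i, j). v $ (i * d + j)) + mat d d (\<lambda>(i, j). v $ (i * d + j)) * S) $$ (i, j)"
    if v: "v \<in> carrier_vec (d * d)" and i: "i < d" and j: "j < d" for v i j
  proof -
    have "(M *\<^sub>v v) $ (i * d + j) = (\<Sum>q<d * d. M $$ (i * d + j, q) * v $ q)"
      using M v lt[OF i j] by (simp add: scalar_prod_def atLeast0LessThan)
    also have "\<dots> = (\<Sum>k<d. \<Sum>l<d. M $$ (i * d + j, k * d + l) * v $ (k * d + l))"
      by (rule sum_lessThan_mult)
    also have "\<dots> = (\<Sum>k<d. \<Sum>l<d. (if l = j then S $$ (i, k) * v $ (k * d + l) else 0) +
        (if k = i then S $$ (l, j) * v $ (k * d + l) else 0))"
      using i j by (intro sum.cong refl) (auto simp: M_def lt ring_distribs)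
    also have "\<dots> = (\<Sum>k<d. S $$ (i, k) * v $ (k * d + j)) + (\<Sum>l<d. S $$ (l, j) * v $ (i * d + l))"
    proof -
      have "(\<Sum>k<d. \<Sum>l<d. (if k = i then S $$ (l, j) * v $ (k * d + l) else 0)) =
        (\<Sum>k<d. if k = i then (\<Sum>l<d. S $$ (l, j) * v $ (k * d + l)) else 0)"
        by (intro sum.cong) auto
      thus ?thesis using i j by (simp add: sum.distrib sum.delta)
    qed
    also have "\<dots> = (S * mat d d (\<lambda>(i, j). v $ (i * d + j)) + mat d d (\<lambda>(i, j). v $ (i * d + j)) * S) $$ (i, j)"
      using Sc i j by (simp add: scalar_prod_def atLeast0LessThan mult.commute)
    finally show ?thesis .
  qed
  have "det M \<noteq> 0"
  proof
    assume "det M = 0"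
    then obtain v where v: "v \<in> carrier_vec (d * d)" "v \<noteq> 0\<^sub>v (d * d)" "M *\<^sub>v v = 0\<^sub>v (d * d)"
      using det_0_iff_vec_prod_zero_field[OF M] by auto
    let ?G = "mat d d (\<lambda>(i, j). v $ (i * d + j))"
    have "S * ?G + ?G * S = 0\<^sub>m d d"
      by (rule eq_matI) (use act[OF v(1)] v(3) lt Sc in auto)
    hence G: "?G = 0\<^sub>m d d" by (rule sylvester_unique_0[OF S mat_carrier])
    have "v = 0\<^sub>v (d * d)"
    proof (rule eq_vecI)
      fix p assume "p < dim_vec (0\<^sub>v (d * d) :: complex vec)"
      hence p: "p < d * d" by simp
      hence d: "d > 0" by (cases d) auto
      have "?G $$ (p div d, p mod d) = 0" unfolding G using p d by (simp add: less_mult_imp_div_less)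
      thus "v $ p = 0\<^sub>v (d * d) $ p" using p d by (simp add: less_mult_imp_div_less)
    qed (use v in auto)
    thus False using v by simp
  qed
  then obtain B where B: "B \<in> carrier_mat (d * d) (d * d)" "M * B = 1\<^sub>m (d * d)"
    using det_non_zero_imp_unit[OF M, of "()"] unfolding Units_def by (auto simp: ring_mat_def)
  show ?thesis
  proof (rule that[of B])
    fix X :: "complex mat" assume X: "X \<in> carrier_mat d d"
    define x where "x = vec (d * d) (\<lambda>p. X $$ (p div d, p mod d))"
    have x: "x \<in> carrier_vec (d * d)" by (simp add: x_def)
    define v where "v = B *\<^sub>v x"
    have v: "v \<in> carrier_vec (d * d)" using B x by (simp add: v_def)
    have "M *\<^sub>v v = x" unfolding v_def
      using assoc_mult_mat_vec[OF M B(1) x] B(2) x by simp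
    have eq: "mat d d (\<lambda>(i, j). \<Sum>p<d * d. B $$ (i * d + j, p) * X $$ (p div d, p mod d)) =
      mat d d (\<lambda>(i, j). v $ (i * d + j))"
      using B lt by (intro eq_matI) (auto simp: v_def x_def scalar_prod_def atLeast0LessThan)
    show "S * mat d d (\<lambda>(i, j). \<Sum>p<d * d. B $$ (i * d + j, p) * X $$ (p div d, p mod d)) +
      mat d d (\<lambda>(i, j). \<Sum>p<d * d. B $$ (i * d + j, p) * X $$ (p div d, p mod d)) * S = X"
      unfolding eq
      by (rule eq_matI) (use act[OF v] \<open>M *\<^sub>v v = x\<close> lt Sc X in \<open>auto simp: x_def\<close>)
  qed
qed

section \<open>Energy decay along a Lindblad semigroup\<close>

text \<open>For skew-adjoint \<open>A\<close>, that is \<open>A = - \<i> H\<close> with a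
  Hamiltonian \<open>H\<close>, this is a Lindblad generator with jump operators \<open>a\<close>
  and \<open>b\<close> at rates \<open>k\<close> and \<open>l\<close>.\<close>

definition lindbladian ::
    "complex mat \<Rightarrow> real \<Rightarrow> complex mat \<Rightarrow> real \<Rightarrow> complex mat \<Rightarrow> complex mat \<Rightarrow> complex mat" where
  "lindbladian A k a l b X = commutator A X + complex_of_real k \<cdot>\<^sub>m dissipator a X
     + complex_of_real l \<cdot>\<^sub>m dissipator b X"

lemma lindbladian_carrier [simp]:
  "A \<in> carrier_mat d d \<Longrightarrow> a \<in> carrier_mat d d \<Longrightarrow> b \<in> carrier_mat d d \<Longrightarrow> X \<in> carrier_mat d d \<Longrightarrow>
   lindbladian A k a l b X \<in> carrier_mat d d"
  unfolding lindbladian_def by auto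

lemma commutator_linear:
  fixes A X Y :: "complex mat"
  assumes "A \<in> carrier_mat d d" "X \<in> carrier_mat d d" "Y \<in> carrier_mat d d"
  shows "commutator A (X - Y) = commutator A X - commutator A Y"
    and "commutator A (c \<cdot>\<^sub>m X) = c \<cdot>\<^sub>m commutator A X"
  unfolding commutator_def
  by (rule eq_matI; use assms in \<open>simp add: square_mat_simps[where d = d] ring_distribs add_divide_distrib diff_divide_distrib del: index_mult_mat(1)\<close>)+

lemma dissipator_linear:
  assumes "L \<in> carrier_mat d d" "X \<in> carrier_mat d d" "Y \<in> carrier_mat d d"
  shows "dissipator L (X - Y) = dissipator L X - dissipator L Y"
    and "dissipator L (c \<cdot>\<^sub>m X) = c \<cdot>\<^sub>m dissipator L X"
  unfolding dissipator_def
  by (rule eq_matI; use assms in \<open>simp add: square_mat_simps[where d = d] ring_distribs add_divide_distrib diff_divide_distrib del: index_mult_mat(1)\<close>)+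

lemma dissipator_adjoint:
  assumes "L \<in> carrier_mat d d" "X \<in> carrier_mat d d"
  shows "dissipator L (mat_adjoint X) = mat_adjoint (dissipator L X)"
  unfolding dissipator_def
  by (rule eq_matI; use assms in \<open>simp add: square_mat_simps[where d = d] mat_adjoint_simps[where d = d]
      mat_adjoint_smult ring_distribs add_divide_distrib diff_divide_distrib del: index_mult_mat(1)\<close>)

lemma commutator_adjoint:
  fixes A X :: "complex mat"
  assumes "A \<in> carrier_mat d d" "mat_adjoint A = - A" "X \<in> carrier_mat d d"
  shows "commutator A (mat_adjoint X) = mat_adjoint (commutator A X)"
  unfolding commutator_def
  by (rule eq_matI; use assms in \<open>simp add: square_mat_simps[where d = d] mat_adjoint_simps[where d = d]
      ring_distribs add_divide_distrib diff_divide_distrib del: index_mult_mat(1)\<close>)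

section \<open>Entrywise differentiation on the half-line of nonnegative times\<close>

definition has_mat_derivative ::
    "nat \<Rightarrow> (real \<Rightarrow> complex mat) \<Rightarrow> complex mat \<Rightarrow> real \<Rightarrow> bool" where
  "has_mat_derivative d F F' t \<longleftrightarrow> (\<forall>i<d. \<forall>j<d.
     ((\<lambda>s. F s $$ (i, j)) has_vector_derivative F' $$ (i, j)) (at t within {0..}))"

lemma has_mat_derivative_const:
  "C \<in> carrier_mat d d \<Longrightarrow> has_mat_derivative d (\<lambda>s. C) (0\<^sub>m d d) t"
  unfolding has_mat_derivative_def by auto

lemma has_mat_derivative_mult:
  assumes F: "has_mat_derivative d F F' t" and H: "has_mat_derivative d H H' t"
    and "\<And>s. F s \<in> carrier_mat d d" "\<And>s. H s \<in> carrier_mat d d"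
    and "F' \<in> carrier_mat d d" "H' \<in> carrier_mat d d"
  shows "has_mat_derivative d (\<lambda>s. F s * H s) (F t * H' + F' * H t) t"
  unfolding has_mat_derivative_def
proof (intro allI impI)
  fix i j assume ij: "i < d" "j < d"
  have "((\<lambda>s. \<Sum>l<d. F s $$ (i, l) * H s $$ (l, j)) has_vector_derivative
      (\<Sum>l<d. F t $$ (i, l) * H' $$ (l, j) + F' $$ (i, l) * H t $$ (l, j))) (at t within {0..})"
    using F H ij unfolding has_mat_derivative_def
    by (intro has_vector_derivative_sum has_vector_derivative_mult) auto
  thus "((\<lambda>s. (F s * H s) $$ (i, j)) has_vector_derivative (F t * H' + F' * H t) $$ (i, j))
      (at t within {0..})"
    using assms ij carrier_matD[OF assms(5)] carrier_matD[OF assms(4)[of t]]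
    by (simp add: index_mult_mat_sum[of _ d d _ d] sum.distrib del: index_mult_mat(1))
qed

lemma has_mat_derivative_trace:
  assumes "has_mat_derivative d F F' t" "\<And>s. F s \<in> carrier_mat d d" "F' \<in> carrier_mat d d"
  shows "((\<lambda>s. mat_trace (F s)) has_vector_derivative mat_trace F') (at t within {0..})"
proof -
  have "((\<lambda>s. \<Sum>i<d. F s $$ (i, i)) has_vector_derivative (\<Sum>i<d. F' $$ (i, i))) (at t within {0..})"
    using assms unfolding has_mat_derivative_def by (intro has_vector_derivative_sum) auto
  moreover have "dim_row (F s) = d" "dim_row F' = d" for s using assms(2)[of s] assms(3) by auto
  ultimately show ?thesis unfolding mat_trace_def by simp
qed

lemma decreasing_if_derivative_nonpos:
  fixes f :: "real \<Rightarrow> real"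
  assumes f: "\<And>t. t \<ge> 0 \<Longrightarrow> (f has_real_derivative f' t) (at t within {0..})"
    and f': "\<And>t. t \<ge> 0 \<Longrightarrow> f' t \<le> 0"
    and t: "t \<ge> 0"
  shows "f t \<le> f 0"
proof (cases "t = 0")
  case False
  have "continuous_on {0..} f"
    using f DERIV_continuous unfolding continuous_on_eq_continuous_within by blast
  hence "continuous_on {0..t} f" by (rule continuous_on_subset) auto
  moreover have "(f has_real_derivative f' x) (at x)" if "0 < x" for x
  proof -
    have "(f has_real_derivative f' x) (at x within {0<..})"
      using f[of x] that by (auto intro: DERIV_subset)
    thus ?thesis using that by (simp add: at_within_open[of x "{0<..}"])
  qed
  ultimately show ?thesis
    using t False f' by (intro DERIV_nonpos_imp_decreasing_open[of 0 t f]) (auto intro!: exI[of _ "f' _"])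
qed simp

text \<open>Irreducibility is asked of \<open>a\<close> alone, the jump operator whose rate is
  strictly positive; \<open>l\<close> corresponds to \<open>\<kappa>\<^sub>c\<close> and may
  vanish.\<close>

locale lindblad_steady_state =
  fixes d :: nat and A :: "complex mat" and k :: real and a :: "complex mat"
    and l :: real and b S :: "complex mat"
  assumes A: "A \<in> carrier_mat d d" "mat_adjoint A = - A"
    and a: "a \<in> carrier_mat d d" and b: "b \<in> carrier_mat d d"
    and k: "0 < k" and l: "0 \<le> l"
    and S: "positive_definite d S" and trace_S: "mat_trace S = 1"
    and steady: "lindbladian A k a l b S = 0\<^sub>m d d"
    and irreducible: "\<And>G. G \<in> carrier_mat d d \<Longrightarrow> mat_adjoint G = G \<Longrightarrow>
      commutator a G = 0\<^sub>m d d \<Longrightarrow> \<exists>c. G = c \<cdot>\<^sub>m 1\<^sub>m d"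
begin

abbreviation gen where "gen \<equiv> lindbladian A k a l b"

lemma S_carrier [simp]: "S \<in> carrier_mat d d"
  using S by (simp add: positive_definite_def)

lemma gen_carrier [simp]: "X \<in> carrier_mat d d \<Longrightarrow> gen X \<in> carrier_mat d d"
  using A a b by simp

lemma gen_linear:
  assumes "X \<in> carrier_mat d d" "Y \<in> carrier_mat d d"
  shows "gen (X - Y) = gen X - gen Y" and "gen (c \<cdot>\<^sub>m X) = c \<cdot>\<^sub>m gen X"
proof -
  note cs = commutator_carrier[OF A(1)] dissipator_carrier[OF a] dissipator_carrier[OF b]
  note ds = cs[THEN carrier_matD(1)] cs[THEN carrier_matD(2)]
  show "gen (X - Y) = gen X - gen Y"
    unfolding lindbladian_def commutator_linear(1)[OF A(1) assms] dissipator_linear(1)[OF a assms]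
      dissipator_linear(1)[OF b assms]
    by (rule eq_matI) (simp_all add: ds assms algebra_simps)
  show "gen (c \<cdot>\<^sub>m X) = c \<cdot>\<^sub>m gen X"
    unfolding lindbladian_def commutator_linear(2)[OF A(1) assms] dissipator_linear(2)[OF a assms]
      dissipator_linear(2)[OF b assms]
    by (rule eq_matI) (simp_all add: ds assms algebra_simps)
qed

lemma gen_adjoint:
  assumes X: "X \<in> carrier_mat d d"
  shows "gen (mat_adjoint X) = mat_adjoint (gen X)"
  using assms A a b unfolding lindbladian_def
  by (simp add: mat_adjoint_simps[where d = d] mat_adjoint_smult commutator_adjoint[of _ d] dissipator_adjoint[of _ d])

lemma trace_gen:
  assumes X: "X \<in> carrier_mat d d"
  shows "mat_trace (gen X) = 0"
  using assms A a b unfolding lindbladian_def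
  by (simp add: mat_trace_add[of _ d] mat_trace_smult[of _ d] mat_trace_commutator[of _ d]
      mat_trace_dissipator[of _ d])

text \<open>The rate at which \<open>energy\<close> is lost along the flow, by
  \<open>energy_derivative\<close>.\<close>

definition diss :: "complex mat \<Rightarrow> real" where
  "diss G = k * Re (mat_trace (S * (mat_adjoint (commutator a G) * commutator a G)))
     + l * Re (mat_trace (S * (mat_adjoint (commutator b G) * commutator b G)))"

text \<open>The Bures functional, regarded as a quadratic form in \<open>G\<close> instead of a
  function of the state.\<close>

definition energy :: "complex mat \<Rightarrow> real" where
  "energy G = Re (mat_trace (S * (G * G)))"

lemma trace_gen_anticommutator:
  assumes G: "G \<in> carrier_mat d d" "mat_adjoint G = G"
  shows "Re (mat_trace (G * gen (S * G + G * S))) = - diss G"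
proof -
  let ?X = "S * G + G * S"
  have X: "?X \<in> carrier_mat d d" using G by simp
  have GG: "G * G \<in> carrier_mat d d" using G by simp
  note cs = commutator_carrier[OF A(1) X] dissipator_carrier[OF a X] dissipator_carrier[OF b X]
    commutator_carrier[OF A(1) S_carrier] dissipator_carrier[OF a S_carrier] dissipator_carrier[OF b S_carrier]
  have "mat_trace (G * gen ?X) = mat_trace (G * commutator A ?X) +
      k * mat_trace (G * dissipator a ?X) + l * mat_trace (G * dissipator b ?X)"
    unfolding lindbladian_def using G cs
    by (simp add: mult_add_distrib_mat[of _ d d _ d] mult_smult_distrib[of _ d d _ d]
        mat_trace_add[of _ d] mat_trace_smult[of _ d] mult_carrier_mat[of _ d d _ d])
  also have "\<dots> = mat_trace (gen S * (G * G))
      - k * mat_trace (S * (mat_adjoint (commutator a G) * commutator a G))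
      - l * mat_trace (S * (mat_adjoint (commutator b G) * commutator b G))"
    unfolding lindbladian_def trace_commutator_anticommutator[OF A(1) S_carrier G(1)]
      trace_dissipator_anticommutator[OF a S_carrier G] trace_dissipator_anticommutator[OF b S_carrier G]
    using GG cs
    by (simp add: add_mult_distrib_mat[of _ d d _ _ d] mult_smult_assoc_mat[of _ d d _ d]
        mat_trace_add[of _ d] mat_trace_smult[of _ d] mult_carrier_mat[of _ d d _ d] algebra_simps)
  also have "mat_trace (gen S * (G * G)) = 0"
    unfolding steady using left_mult_zero_mat[OF GG] by (simp add: mat_trace_def)
  finally show ?thesis by (simp add: diss_def)
qed

lemma diss_nonneg:
  assumes "G \<in> carrier_mat d d"
  shows "0 \<le> diss G"
proof -
  have "0 \<le> mat_trace (S * (mat_adjoint (commutator a G) * commutator a G))"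
    and "0 \<le> mat_trace (S * (mat_adjoint (commutator b G) * commutator b G))"
    using assms a b by (auto intro!: trace_sandwich_nonneg[OF S])
  thus ?thesis unfolding diss_def using k l by (auto simp: less_eq_complex_def)
qed

lemma diss_eq_0:
  assumes G: "G \<in> carrier_mat d d" "mat_adjoint G = G" "mat_trace (S * G) = 0" and "diss G = 0"
  shows "G = 0\<^sub>m d d"
proof -
  have ca: "commutator a G \<in> carrier_mat d d" and cb: "commutator b G \<in> carrier_mat d d"
    using a b G by auto
  have 1: "0 \<le> mat_trace (S * (mat_adjoint (commutator a G) * commutator a G))"
    and 2: "0 \<le> mat_trace (S * (mat_adjoint (commutator b G) * commutator b G))"
    using ca cb by (auto intro!: trace_sandwich_nonneg[OF S])
  have "k * Re (mat_trace (S * (mat_adjoint (commutator a G) * commutator a G))) = 0"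
    using \<open>diss G = 0\<close> 1 2 k l unfolding diss_def
    by (subst (asm) add_nonneg_eq_0_iff) (auto simp: less_eq_complex_def)
  hence "mat_trace (S * (mat_adjoint (commutator a G) * commutator a G)) = 0"
    using k 1 by (auto simp: less_eq_complex_def complex_eq_iff)
  hence "commutator a G = 0\<^sub>m d d" by (rule trace_sandwich_eq_0[OF S ca])
  then obtain c where c: "G = c \<cdot>\<^sub>m 1\<^sub>m d" using irreducible G by blast
  hence "S * G = c \<cdot>\<^sub>m S"
    using mult_smult_distrib[OF S_carrier, of "1\<^sub>m d" d c] right_mult_one_mat[OF S_carrier] by simp
  hence "c = 0" using G(3) trace_S mat_trace_smult[OF S_carrier, of c] by simp
  thus ?thesis unfolding c by auto
qed

lemma energy_nonneg:
  assumes "G \<in> carrier_mat d d" "mat_adjoint G = G"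
  shows "0 \<le> energy G"
  using trace_sandwich_nonneg[OF S assms(1)] assms(2) unfolding energy_def
  by (simp add: less_eq_complex_def)

lemma energy_eq_0:
  assumes "G \<in> carrier_mat d d" "mat_adjoint G = G" "energy G = 0"
  shows "G = 0\<^sub>m d d"
  using trace_sandwich_nonneg[OF S assms(1)] trace_sandwich_eq_0[OF S assms(1)] assms(2,3)
  unfolding energy_def by (auto simp: less_eq_complex_def complex_eq_iff)

text \<open>Since \<open>S\<close> and the right-hand side are self-adjoint, the adjoint of
  \<open>G\<close> solves the same equation; uniqueness identifies the two.\<close>

lemma solution_adjoint:
  assumes G: "G \<in> carrier_mat d d" and herm: "mat_adjoint (S * G + G * S) = S * G + G * S"
  shows "mat_adjoint G = G"
proof (rule sylvester_unique[OF S])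
  have "S * mat_adjoint G + mat_adjoint G * S = mat_adjoint (S * G + G * S)"
    unfolding mat_adjoint_add[OF mult_carrier_mat[OF S_carrier G] mult_carrier_mat[OF G S_carrier]]
      mat_adjoint_mult[OF S_carrier G] mat_adjoint_mult[OF G S_carrier]
    using S mult_carrier_mat[OF S_carrier mat_adjoint_carrier[OF G]]
      mult_carrier_mat[OF mat_adjoint_carrier[OF G] S_carrier]
    by (simp add: positive_definite_def comm_add_mat[of _ d d])
  thus "S * mat_adjoint G + mat_adjoint G * S = S * G + G * S" using herm by simp
qed (use G in auto)

definition solve :: "complex mat \<Rightarrow> complex mat" where
  "solve X = (THE G. G \<in> carrier_mat d d \<and> S * G + G * S = X)"

lemma solve:
  assumes X: "X \<in> carrier_mat d d"
  shows solve_carrier: "solve X \<in> carrier_mat d d"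
    and solve_eq: "S * solve X + solve X * S = X"
    and solve_unique: "G \<in> carrier_mat d d \<Longrightarrow> S * G + G * S = X \<Longrightarrow> solve X = G"
proof -
  obtain B where B: "\<And>X. X \<in> carrier_mat d d \<Longrightarrow>
      S * mat d d (\<lambda>(i, j). \<Sum>p<d * d. B $$ (i * d + j, p) * X $$ (p div d, p mod d)) +
      mat d d (\<lambda>(i, j). \<Sum>p<d * d. B $$ (i * d + j, p) * X $$ (p div d, p mod d)) * S = X"
    using sylvester_solution[OF S] by blast
  have "\<exists>!G. G \<in> carrier_mat d d \<and> S * G + G * S = X"
  proof (rule ex_ex1I)
    show "\<exists>G. G \<in> carrier_mat d d \<and> S * G + G * S = X"
      by (rule exI, rule conjI, rule mat_carrier, rule B[OF X])
    show "G = H" if "G \<in> carrier_mat d d \<and> S * G + G * S = X" "H \<in> carrier_mat d d \<and> S * H + H * S = X" for G H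
      using that sylvester_unique[OF S, of G H] by simp
  qed
  hence "solve X \<in> carrier_mat d d \<and> S * solve X + solve X * S = X"
    unfolding solve_def by (rule theI')
  thus sol: "solve X \<in> carrier_mat d d" "S * solve X + solve X * S = X" by simp_all
  show "solve X = G" if "G \<in> carrier_mat d d" "S * G + G * S = X"
    by (rule sylvester_unique[OF S sol(1) that(1)]) (simp add: sol that)
qed

lemma solve_hermitian:
  assumes "X \<in> carrier_mat d d" "mat_adjoint X = X"
  shows "mat_adjoint (solve X) = solve X"
  by (rule solution_adjoint) (simp_all add: assms solve_carrier solve_eq)

lemma solve_eq_0_iff:
  assumes X: "X \<in> carrier_mat d d"
  shows "solve X = 0\<^sub>m d d \<longleftrightarrow> X = 0\<^sub>m d d"
proof
  assume "solve X = 0\<^sub>m d d"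
  thus "X = 0\<^sub>m d d"
    using solve_eq[OF X] right_mult_zero_mat[OF S_carrier] left_mult_zero_mat[OF S_carrier] by simp
qed (use right_mult_zero_mat[OF S_carrier] left_mult_zero_mat[OF S_carrier] in \<open>auto intro!: solve_unique\<close>)

text \<open>Converts the normalisation of states, \<open>Tr X = 0\<close> for a difference, into the
  condition on \<open>G\<close> that excludes nonzero scalars in \<open>diss_eq_0\<close>.\<close>

lemma trace_solve:
  assumes X: "X \<in> carrier_mat d d"
  shows "mat_trace (S * solve X) = mat_trace X / 2"
proof -
  have "mat_trace X = mat_trace (S * solve X + solve X * S)" using solve_eq[OF X] by simp
  also have "\<dots> = 2 * mat_trace (S * solve X)"
    using solve_carrier[OF X] S_carrier by (simp add: square_mat_simps[where d = d] mat_trace_add[of _ d] mat_trace_rotate[of S d])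
  finally show ?thesis by simp
qed

text \<open>\<open>X\<close> is controlled only at nonnegative times, whereas the product rule asks
  for square matrices at all times. \<open>H\<close> is the explicit linear formula of
  \<open>sylvester_solution\<close> applied to \<open>X\<close>: it always has the right dimensions
  and agrees with \<open>solve\<close> where this matters.\<close>

lemma has_mat_derivative_solve:
  assumes X: "\<And>s. s \<ge> 0 \<Longrightarrow> X s \<in> carrier_mat d d" and X': "X' \<in> carrier_mat d d"
    and t: "t \<ge> 0" and deriv: "has_mat_derivative d X X' t"
  obtains H where "\<And>s. H s \<in> carrier_mat d d" "\<And>s. s \<ge> 0 \<Longrightarrow> H s = solve (X s)"
    "has_mat_derivative d H (solve X') t"
proof -
  obtain B where B: "\<And>X. X \<in> carrier_mat d d \<Longrightarrow>
      S * mat d d (\<lambda>(i, j). \<Sum>p<d * d. B $$ (i * d + j, p) * X $$ (p div d, p mod d)) +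
      mat d d (\<lambda>(i, j). \<Sum>p<d * d. B $$ (i * d + j, p) * X $$ (p div d, p mod d)) * S = X"
    using sylvester_solution[OF S] by blast
  define T where "T X = mat d d (\<lambda>(i, j). \<Sum>p<d * d. B $$ (i * d + j, p) * X $$ (p div d, p mod d))" for X
  have T: "T X \<in> carrier_mat d d" for X by (simp add: T_def)
  have sol: "solve X = T X" if "X \<in> carrier_mat d d" for X
    by (rule solve_unique[OF that T]) (unfold T_def, rule B[OF that])
  have "has_mat_derivative d (\<lambda>s. T (X s)) (T X') t"
    unfolding has_mat_derivative_def
  proof (intro allI impI)
    fix i j assume ij: "i < d" "j < d"
    have "p div d < d \<and> p mod d < d" if "p < d * d" for p
      using ij that by (simp add: less_mult_imp_div_less)
    hence "((\<lambda>s. \<Sum>p<d * d. B $$ (i * d + j, p) * X s $$ (p div d, p mod d)) has_vector_derivative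
      (\<Sum>p<d * d. B $$ (i * d + j, p) * X' $$ (p div d, p mod d))) (at t within {0..})"
      using deriv unfolding has_mat_derivative_def
      by (intro has_vector_derivative_sum has_vector_derivative_mult_right) auto
    thus "((\<lambda>s. T (X s) $$ (i, j)) has_vector_derivative T X' $$ (i, j)) (at t within {0..})"
      using ij by (simp add: T_def)
  qed
  hence "has_mat_derivative d (\<lambda>s. T (X s)) (solve X') t" by (simp only: sol[OF X'])
  thus ?thesis by (rule that[of "\<lambda>s. T (X s)", rotated 2]) (simp_all only: T sol X)
qed

text \<open>The product rule gives \<open>Tr (S (G G' + G' G))\<close>, which rotates to
  \<open>Tr (G (S G' + G' S))\<close>. As \<open>G'\<close> solves the equation with right-hand side
  \<open>gen (X t)\<close>, this is the trace evaluated in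
  \<open>trace_gen_anticommutator\<close>.\<close>

lemma energy_derivative:
  assumes X: "\<And>s. s \<ge> 0 \<Longrightarrow> X s \<in> carrier_mat d d" and t: "t \<ge> 0"
    and herm: "mat_adjoint (X t) = X t" and deriv: "has_mat_derivative d X (gen (X t)) t"
  shows "((\<lambda>s. energy (solve (X s))) has_real_derivative - diss (solve (X t))) (at t within {0..})"
proof -
  define G where "G = solve (X t)"
  define G' where "G' = solve (gen (X t))"
  have Xt: "X t \<in> carrier_mat d d" by (rule X[OF t])
  have Xt': "gen (X t) \<in> carrier_mat d d" by (rule gen_carrier[OF Xt])
  obtain H where H: "\<And>s. H s \<in> carrier_mat d d" "\<And>s. s \<ge> 0 \<Longrightarrow> H s = solve (X s)"
    "has_mat_derivative d H G' t"
    unfolding G'_def by (rule has_mat_derivative_solve[OF X Xt' t deriv]) iprover+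
  have Ht: "H t = G" using H(2) t by (simp add: G_def)
  have G: "G \<in> carrier_mat d d" "G' \<in> carrier_mat d d"
    unfolding G_def G'_def using Xt Xt' by (auto intro: solve_carrier)
  have HH: "H s * H s \<in> carrier_mat d d" for s by (rule mult_carrier_mat[OF H(1) H(1)])
  have GG: "G * G' + G' * G \<in> carrier_mat d d"
    by (rule add_carrier_mat[OF mult_carrier_mat[OF G(2) G(1)]])
  have "has_mat_derivative d (\<lambda>s. S * (H s * H s)) (S * (G * G' + G' * G) + 0\<^sub>m d d * (G * G)) t"
    unfolding Ht[symmetric]
    by (intro has_mat_derivative_mult has_mat_derivative_const H(1,3) S_carrier G HH
        GG[folded Ht] zero_carrier_mat)
  moreover have "0\<^sub>m d d * (G * G) = 0\<^sub>m d d" using left_mult_zero_mat[of "G * G" d d d] G by auto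
  ultimately have "((\<lambda>s. mat_trace (S * (H s * H s))) has_vector_derivative
      mat_trace (S * (G * G' + G' * G))) (at t within {0..})"
    using HH GG right_add_zero_mat[OF mult_carrier_mat[OF S_carrier GG]]
    by (intro has_mat_derivative_trace[where d = d] mult_carrier_mat[OF S_carrier]) simp_all
  hence "((\<lambda>s. Re (mat_trace (S * (H s * H s)))) has_vector_derivative
      Re (mat_trace (S * (G * G' + G' * G)))) (at t within {0..})"
    by (rule bounded_linear.has_vector_derivative[OF bounded_linear_Re])
  moreover have "mat_trace (S * (G * G' + G' * G)) = mat_trace (G * (S * G' + G' * S))"
    using G by (simp add: square_mat_simps[where d = d] mat_trace_add[of _ d] mat_trace_rotate[of S d])
  moreover have "S * G' + G' * S = gen (S * G + G * S)"
    unfolding G_def G'_def by (simp add: solve_eq Xt)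
  moreover have "mat_adjoint G = G" unfolding G_def using Xt herm by (rule solve_hermitian)
  ultimately have "((\<lambda>s. energy (H s)) has_real_derivative - diss G) (at t within {0..})"
    using trace_gen_anticommutator[OF G(1)]
    by (simp add: energy_def has_real_derivative_iff_has_vector_derivative)
  \<comment> \<open>\<open>H\<close> and \<open>solve (X s)\<close> agree for
    \<open>s \<ge> 0\<close>, which settles a derivative within \<open>{0..}\<close>; the radius 1
    is arbitrary.\<close>
  thus ?thesis unfolding G_def
    by (rule has_field_derivative_transform_within[of _ _ _ _ 1]) (use t H in auto)
qed

text \<open>Takes the place of a uniqueness theorem for the linear equation: the generator commutes
  with the adjoint, so \<open>K\<close> below is again a solution, and its energy is nonnegative,
  nonincreasing and initially 0.\<close>

lemma hermitian_preserved:
  assumes Y: "\<And>s. s \<ge> 0 \<Longrightarrow> Y s \<in> carrier_mat d d"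
    and deriv: "\<And>s. s \<ge> 0 \<Longrightarrow> has_mat_derivative d Y (gen (Y s)) s"
    and init: "mat_adjoint (Y 0) = Y 0" and t: "t \<ge> 0"
  shows "mat_adjoint (Y t) = Y t"
proof -
  \<comment> \<open>The factor \<open>\<i>\<close> turns a skew-adjoint difference into a
    self-adjoint matrix, as \<open>energy_derivative\<close> demands.\<close>
  define K where "K s = \<i> \<cdot>\<^sub>m (Y s - mat_adjoint (Y s))" for s
  have K: "K s \<in> carrier_mat d d" if "s \<ge> 0" for s using Y[OF that] by (auto simp: K_def)
  have herm: "mat_adjoint (K s) = K s" if "s \<ge> 0" for s
    using Y[OF that] unfolding K_def by (intro eq_matI) (auto simp: index_mat_adjoint algebra_simps)
  have K': "has_mat_derivative d K (gen (K s)) s" if s: "s \<ge> 0" for s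
    unfolding has_mat_derivative_def
  proof (intro allI impI)
    fix i j assume ij: "i < d" "j < d"
    have g: "gen (K s) = \<i> \<cdot>\<^sub>m (gen (Y s) - mat_adjoint (gen (Y s)))"
      unfolding K_def gen_linear(2)[OF minus_carrier_mat[OF mat_adjoint_carrier[OF Y[OF s]]] zero_carrier_mat]
        gen_linear(1)[OF Y[OF s] mat_adjoint_carrier[OF Y[OF s]]] gen_adjoint[OF Y[OF s]] ..
    have D: "((\<lambda>r. Y r $$ (i, j)) has_vector_derivative gen (Y s) $$ (i, j)) (at s within {0..})"
      if "i < d" "j < d" for i j
      using deriv[OF s] that unfolding has_mat_derivative_def by auto
    have "((\<lambda>r. \<i> * (Y r $$ (i, j) - cnj (Y r $$ (j, i)))) has_vector_derivative
        \<i> * (gen (Y s) $$ (i, j) - cnj (gen (Y s) $$ (j, i)))) (at s within {0..})"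
      using ij by (intro has_vector_derivative_mult_right has_vector_derivative_diff D
          bounded_linear.has_vector_derivative[OF bounded_linear_cnj])
    moreover have "gen (K s) $$ (i, j) = \<i> * (gen (Y s) $$ (i, j) - cnj (gen (Y s) $$ (j, i)))"
      unfolding g using ij carrier_matD[OF gen_carrier[OF Y[OF s]]] by (simp add: index_mat_adjoint)
    moreover have "K r $$ (i, j) = \<i> * (Y r $$ (i, j) - cnj (Y r $$ (j, i)))" if "r \<ge> 0" for r
      unfolding K_def using Y[OF that] ij by (auto simp: index_mat_adjoint)
    ultimately show "((\<lambda>r. K r $$ (i, j)) has_vector_derivative gen (K s) $$ (i, j)) (at s within {0..})"
      using s unfolding has_vector_derivative_def
      by (auto intro: has_derivative_transform)
  qed
  have sK: "solve (K s) \<in> carrier_mat d d" "mat_adjoint (solve (K s)) = solve (K s)" if "s \<ge> 0" for s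
    using K[OF that] herm[OF that] by (simp_all add: solve_carrier solve_hermitian)
  have "energy (solve (K t)) \<le> energy (solve (K 0))"
  proof (rule decreasing_if_derivative_nonpos[OF _ _ t])
    fix s :: real assume s: "s \<ge> 0"
    show "((\<lambda>s. energy (solve (K s))) has_real_derivative - diss (solve (K s))) (at s within {0..})"
      by (rule energy_derivative[OF K s herm[OF s] K'[OF s]])
    show "- diss (solve (K s)) \<le> 0" using diss_nonneg[OF sK(1)[OF s]] by simp
  qed
  also have "K 0 = 0\<^sub>m d d" unfolding K_def using init Y[of 0] by (intro eq_matI) auto
  hence "solve (K 0) = 0\<^sub>m d d" by (simp add: solve_eq_0_iff)
  hence "energy (solve (K 0)) = 0"
    using right_mult_zero_mat[OF S_carrier] by (simp add: energy_def mat_trace_def)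
  finally have "energy (solve (K t)) = 0" using energy_nonneg[OF sK[OF t]] by simp
  hence "solve (K t) = 0\<^sub>m d d" by (rule energy_eq_0[OF sK[OF t]])
  hence "K t = 0\<^sub>m d d" using K[OF t] by (simp add: solve_eq_0_iff)
  show ?thesis
  proof (rule eq_matI)
    fix i j assume ij: "i < dim_row (Y t)" "j < dim_col (Y t)"
    have "K t $$ (i, j) = 0" using \<open>K t = 0\<^sub>m d d\<close> ij Y[OF t] by simp
    thus "mat_adjoint (Y t) $$ (i, j) = Y t $$ (i, j)"
      using ij Y[OF t] by (auto simp: K_def index_mat_adjoint)
  qed (use Y[OF t] in auto)
qed

lemma trace_preserved:
  assumes Y: "\<And>s. s \<ge> 0 \<Longrightarrow> Y s \<in> carrier_mat d d"
    and deriv: "\<And>s. s \<ge> 0 \<Longrightarrow> has_mat_derivative d Y (gen (Y s)) s" and t: "t \<ge> 0"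
  shows "mat_trace (Y t) = mat_trace (Y 0)"
proof -
  \<comment> \<open>\<open>mat_trace\<close> sums up to the row dimension, which is known only at
    nonnegative times; the sum with fixed range \<open>d\<close> is the one to
    differentiate.\<close>
  have tr: "mat_trace (Y s) = (\<Sum>i<d. Y s $$ (i, i))" if "s \<ge> 0" for s
    using Y[OF that] by (simp add: mat_trace_def)
  have "((\<lambda>s. \<Sum>i<d. Y s $$ (i, i)) has_vector_derivative 0) (at s within {0..})" if s: "s \<ge> 0" for s
  proof -
    have "((\<lambda>s. \<Sum>i<d. Y s $$ (i, i)) has_vector_derivative (\<Sum>i<d. gen (Y s) $$ (i, i))) (at s within {0..})"
      using deriv[OF s] unfolding has_mat_derivative_def by (intro has_vector_derivative_sum) auto
    also have "(\<Sum>i<d. gen (Y s) $$ (i, i)) = mat_trace (gen (Y s))"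
      using gen_carrier[OF Y[OF s]] by (simp add: mat_trace_def)
    also have "\<dots> = 0" by (rule trace_gen[OF Y[OF s]])
    finally show ?thesis .
  qed
  note const = this
  \<comment> \<open>Monotonicity is available for real functions; the choices \<open>1\<close>,
    \<open>- 1\<close>, \<open>\<i>\<close>, \<open>- \<i>\<close> of \<open>u\<close> bound real
    and imaginary parts from both sides.\<close>
  have "Re (u * (\<Sum>i<d. Y t $$ (i, i))) \<le> Re (u * (\<Sum>i<d. Y 0 $$ (i, i)))" for u
  proof (rule decreasing_if_derivative_nonpos[where f' = "\<lambda>_. 0", OF _ _ t])
    fix s :: real assume "s \<ge> 0"
    hence "((\<lambda>s. Re (u * (\<Sum>i<d. Y s $$ (i, i)))) has_vector_derivative Re (u * 0)) (at s within {0..})"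
      by (intro bounded_linear.has_vector_derivative[OF bounded_linear_Re]
          has_vector_derivative_mult_right const)
    thus "((\<lambda>s. Re (u * (\<Sum>i<d. Y s $$ (i, i)))) has_real_derivative 0) (at s within {0..})"
      by (simp add: has_real_derivative_iff_has_vector_derivative)
  qed simp
  from this[of 1] this[of "- 1"] this[of \<i>] this[of "- \<i>"]
  have "(\<Sum>i<d. Y t $$ (i, i)) = (\<Sum>i<d. Y 0 $$ (i, i))"
    by (simp add: complex_eq_iff)
  thus ?thesis using t tr by simp
qed

end

section \<open>Exponential decay by compactness\<close>

text \<open>Continuity with respect to the product topology on entry functions \<open>g\<close>,
  where the compactness argument takes place.\<close>

definition continuous_mat :: "nat \<Rightarrow> ((nat \<times> nat \<Rightarrow> complex) \<Rightarrow> complex mat) \<Rightarrow> bool" where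
  "continuous_mat d F \<longleftrightarrow> (\<forall>i<d. \<forall>j<d. continuous_on UNIV (\<lambda>g. F g $$ (i, j)))"

lemma continuous_mat_const: "continuous_mat d (\<lambda>g. C)"
  unfolding continuous_mat_def by simp

lemma continuous_mat_mat: "continuous_mat d (\<lambda>g. mat d d g)"
  unfolding continuous_mat_def by simp

lemma continuous_mat_mult:
  assumes F: "continuous_mat d F" "\<And>g. F g \<in> carrier_mat d d"
    and H: "continuous_mat d H" "\<And>g. H g \<in> carrier_mat d d"
  shows "continuous_mat d (\<lambda>g. F g * H g)"
  unfolding continuous_mat_def
proof (intro allI impI)
  fix i j assume ij: "i < d" "j < d"
  have "continuous_on UNIV (\<lambda>g. \<Sum>l<d. F g $$ (i, l) * H g $$ (l, j))"
    using F(1) H(1) ij unfolding continuous_mat_def by (intro continuous_on_sum continuous_on_mult) auto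
  thus "continuous_on UNIV (\<lambda>g. (F g * H g) $$ (i, j))"
    by (simp only: index_mult_mat_sum[OF F(2) H(2) ij])
qed

lemma continuous_mat_minus:
  assumes "continuous_mat d F" "continuous_mat d H" "\<And>g. H g \<in> carrier_mat d d"
  shows "continuous_mat d (\<lambda>g. F g - H g)"
  unfolding continuous_mat_def
proof (intro allI impI)
  fix i j assume ij: "i < d" "j < d"
  have "continuous_on UNIV (\<lambda>g. F g $$ (i, j) - H g $$ (i, j))"
    using assms(1,2) ij unfolding continuous_mat_def by (intro continuous_on_diff) auto
  thus "continuous_on UNIV (\<lambda>g. (F g - H g) $$ (i, j))"
    using ij carrier_matD[OF assms(3)] by simp
qed

lemma continuous_mat_adjoint:
  assumes "continuous_mat d F" "\<And>g. F g \<in> carrier_mat d d"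
  shows "continuous_mat d (\<lambda>g. mat_adjoint (F g))"
  unfolding continuous_mat_def
proof (intro allI impI)
  fix i j assume ij: "i < d" "j < d"
  have "continuous_on UNIV (\<lambda>g. cnj (F g $$ (j, i)))"
    using assms(1) ij unfolding continuous_mat_def by (intro continuous_on_cnj) auto
  thus "continuous_on UNIV (\<lambda>g. mat_adjoint (F g) $$ (i, j))"
    using ij carrier_matD[OF assms(2)] by (simp add: index_mat_adjoint)
qed

lemma continuous_mat_trace:
  assumes "continuous_mat d F" "\<And>g. F g \<in> carrier_mat d d"
  shows "continuous_on UNIV (\<lambda>g. mat_trace (F g))"
proof -
  have "continuous_on UNIV (\<lambda>g. \<Sum>i<d. F g $$ (i, i))"
    using assms(1) unfolding continuous_mat_def by (intro continuous_on_sum) auto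
  thus ?thesis using carrier_matD[OF assms(2)] by (simp add: mat_trace_def)
qed

section \<open>The Frobenius norm, its unit sphere and comparison of quadratic forms\<close>

definition frobenius_sq :: "complex mat \<Rightarrow> real" where
  "frobenius_sq A = (\<Sum>i<dim_row A. \<Sum>j<dim_col A. (cmod (A $$ (i, j)))\<^sup>2)"

lemma entry_le_frobenius_sq:
  assumes "A \<in> carrier_mat n m" "i < n" "j < m"
  shows "(cmod (A $$ (i, j)))\<^sup>2 \<le> frobenius_sq A"
proof -
  have "(cmod (A $$ (i, j)))\<^sup>2 \<le> (\<Sum>j<m. (cmod (A $$ (i, j)))\<^sup>2)"
    using assms by (intro member_le_sum) auto
  also have "\<dots> \<le> (\<Sum>i<n. \<Sum>j<m. (cmod (A $$ (i, j)))\<^sup>2)"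
    using assms by (intro member_le_sum[where f = "\<lambda>i. \<Sum>j<m. (cmod (A $$ (i, j)))\<^sup>2"])
      (auto intro!: sum_nonneg)
  finally show ?thesis using assms by (simp add: frobenius_sq_def)
qed

lemma frobenius_sq_smult: "frobenius_sq (complex_of_real r \<cdot>\<^sub>m A) = r\<^sup>2 * frobenius_sq A"
  unfolding frobenius_sq_def by (simp add: norm_mult power_mult_distrib sum_distrib_left)

lemma frobenius_sq_nonneg: "0 \<le> frobenius_sq A"
  unfolding frobenius_sq_def by (intro sum_nonneg) simp

lemma frobenius_sq_eq_0:
  assumes "A \<in> carrier_mat n m" "frobenius_sq A = 0"
  shows "A = 0\<^sub>m n m"
proof (rule eq_matI)
  fix i j assume ij: "i < dim_row (0\<^sub>m n m :: complex mat)" "j < dim_col (0\<^sub>m n m :: complex mat)"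
  hence "(cmod (A $$ (i, j)))\<^sup>2 \<le> 0" using entry_le_frobenius_sq[OF assms(1)] assms(2) by simp
  thus "A $$ (i, j) = 0\<^sub>m n m $$ (i, j)" using ij by simp
qed (use assms in auto)

lemma continuous_frobenius_sq:
  "continuous_on UNIV (\<lambda>g :: nat \<times> nat \<Rightarrow> complex. frobenius_sq (mat d d g))"
proof -
  have "continuous_on UNIV (\<lambda>g :: nat \<times> nat \<Rightarrow> complex. \<Sum>i<d. \<Sum>j<d. (cmod (g (i, j)))\<^sup>2)"
    by (intro continuous_on_sum continuous_on_power continuous_on_norm continuous_on_product_coordinates)
  thus ?thesis by (simp add: frobenius_sq_def)
qed

lemma compact_complex_square: "compact {z. Re z \<in> {-1..1} \<and> Im z \<in> {-1..1}}"
proof -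
  have "compact ((\<lambda>p. complex_of_real (fst p) + \<i> * complex_of_real (snd p)) ` ({-1..1} \<times> {-1..1}))"
    by (intro compact_continuous_image compact_Times compact_Icc continuous_intros)
  also have "(\<lambda>p. complex_of_real (fst p) + \<i> * complex_of_real (snd p)) ` ({-1..1} \<times> {-1..1}) =
      {z. Re z \<in> {-1..1} \<and> Im z \<in> {-1..1}}"
  proof (intro equalityI subsetI)
    fix z assume "z \<in> {z. Re z \<in> {-1..1} \<and> Im z \<in> {-1..1}}"
    moreover have "z = complex_of_real (fst (Re z, Im z)) + \<i> * complex_of_real (snd (Re z, Im z))"
      by (simp add: complex_eq_iff)
    ultimately show "z \<in> (\<lambda>p. complex_of_real (fst p) + \<i> * complex_of_real (snd p)) ` ({-1..1} \<times> {-1..1})"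
      by (intro image_eqI[where x = "(Re z, Im z)"]) auto
  qed auto
  finally show ?thesis .
qed

text \<open>Matrices carry no topology; functions vanishing off the index square stand in for them.\<close>

lemma compact_unit_sphere:
  "compact {g :: nat \<times> nat \<Rightarrow> complex. (\<forall>p. p \<notin> {..<d} \<times> {..<d} \<longrightarrow> g p = 0) \<and> frobenius_sq (mat d d g) = 1}"
    (is "compact ?K")
proof -
  \<comment> \<open>Entries of a matrix of Frobenius norm 1 have modulus at most 1, so the sphere is
    a closed subset of a product of compact squares and, off the index range, singletons.
    Tychonoff's theorem makes the product compact.\<close>
  define U :: "nat \<times> nat \<Rightarrow> complex set"
    where "U p = (if p \<in> {..<d} \<times> {..<d} then {z. Re z \<in> {-1..1} \<and> Im z \<in> {-1..1}} else {0})" for p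
  have "compact (U p)" for p using compact_complex_square by (simp add: U_def)
  hence U: "compact (Pi\<^sub>E UNIV U)"
    unfolding compactin_euclidean_iff[symmetric] euclidean_product_topology[symmetric]
    by (subst compactin_PiE) simp
  have "closed {g :: nat \<times> nat \<Rightarrow> complex. frobenius_sq (mat d d g) = 1}"
    by (intro closed_Collect_eq continuous_frobenius_sq continuous_on_const)
  hence "compact (Pi\<^sub>E UNIV U \<inter> {g. frobenius_sq (mat d d g) = 1})"
    using U by (rule compact_Int_closed[rotated])
  also have "Pi\<^sub>E UNIV U \<inter> {g. frobenius_sq (mat d d g) = 1} = ?K"
  proof (intro Set.set_eqI iffI)
    fix g assume "g \<in> Pi\<^sub>E UNIV U \<inter> {g. frobenius_sq (mat d d g) = 1}"
    hence "g p \<in> U p" and "frobenius_sq (mat d d g) = 1" for p by auto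
    thus "g \<in> ?K" unfolding U_def by (auto split: if_splits) (metis singletonD)+
  next
    fix g assume g: "g \<in> ?K"
    have "g p \<in> U p" for p
    proof (cases "p \<in> {..<d} \<times> {..<d}")
      case True
      then obtain i j where p: "p = (i, j)" "i < d" "j < d" by auto
      have "(cmod (mat d d g $$ (i, j)))\<^sup>2 \<le> 1"
        using entry_le_frobenius_sq[OF mat_carrier p(2,3), of g] g by simp
      hence "cmod (g p) \<le> 1" using p by (simp add: power_le_one_iff abs_square_le_1)
      thus ?thesis using True abs_Re_le_cmod[of "g p"] abs_Im_le_cmod[of "g p"] by (auto simp: U_def)
    next
      case False
      moreover have "g p = 0" using False g by blast
      ultimately show ?thesis by (simp add: U_def)
    qed
    thus "g \<in> Pi\<^sub>E UNIV U \<inter> {g. frobenius_sq (mat d d g) = 1}" using g by auto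
  qed
  finally show ?thesis .
qed

text \<open>On the unit vectors of the cone, a compact set, \<open>F\<close> has a positive minimum
  and \<open>H\<close> is bounded above; the common degree 2 of homogeneity carries the ratio to the
  whole cone.\<close>

lemma homogeneous_comparison:
  fixes F H :: "complex mat \<Rightarrow> real" and C :: "complex mat set"
  assumes F: "continuous_on UNIV (\<lambda>g. F (mat d d g))" and H: "continuous_on UNIV (\<lambda>g. H (mat d d g))"
    and C: "closed {g. mat d d g \<in> C}"
    and cone: "\<And>r A. A \<in> carrier_mat d d \<Longrightarrow> A \<in> C \<Longrightarrow> complex_of_real r \<cdot>\<^sub>m A \<in> C"
    and homF: "\<And>r A. A \<in> carrier_mat d d \<Longrightarrow> F (complex_of_real r \<cdot>\<^sub>m A) = r\<^sup>2 * F A"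
    and homH: "\<And>r A. A \<in> carrier_mat d d \<Longrightarrow> H (complex_of_real r \<cdot>\<^sub>m A) = r\<^sup>2 * H A"
    and pos: "\<And>A. A \<in> carrier_mat d d \<Longrightarrow> A \<in> C \<Longrightarrow> A \<noteq> 0\<^sub>m d d \<Longrightarrow> 0 < F A"
  obtains c where "c > 0" "\<And>A. A \<in> carrier_mat d d \<Longrightarrow> A \<in> C \<Longrightarrow> c * H A \<le> F A"
proof -
  define K where "K = {g :: nat \<times> nat \<Rightarrow> complex.
    (\<forall>p. p \<notin> {..<d} \<times> {..<d} \<longrightarrow> g p = 0) \<and> frobenius_sq (mat d d g) = 1} \<inter> {g. mat d d g \<in> C}"
  have K: "compact K" unfolding K_def by (intro compact_Int_closed compact_unit_sphere C)
  have posK: "0 < F (mat d d g)" if "g \<in> K" for g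
  proof (rule pos[OF mat_carrier])
    show "mat d d g \<in> C" using that by (simp add: K_def)
    have "frobenius_sq (mat d d g) = 1" using that by (simp add: K_def)
    moreover have "frobenius_sq (0\<^sub>m d d) = 0" by (simp add: frobenius_sq_def)
    ultimately show "mat d d g \<noteq> 0\<^sub>m d d" by auto
  qed
  obtain c where c: "c > 0" "\<And>g. g \<in> K \<Longrightarrow> c * H (mat d d g) \<le> F (mat d d g)"
  \<comment> \<open>The sphere misses the cone when \<open>C\<close> contains no nonzero matrix of
    this size; then any constant serves.\<close>
  proof (cases "K = {}")
    case True
    thus ?thesis using that[of 1] by simp
  next
    case False
    obtain g where g: "g \<in> K" "\<And>h. h \<in> K \<Longrightarrow> F (mat d d g) \<le> F (mat d d h)"
      using continuous_attains_inf[OF K False continuous_on_subset[OF F]] by auto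
    obtain g' where g': "\<And>h. h \<in> K \<Longrightarrow> H (mat d d h) \<le> H (mat d d g')"
      using continuous_attains_sup[OF K False continuous_on_subset[OF H]] by auto
    define m where "m = F (mat d d g)"
    \<comment> \<open>The maximum of \<open>H\<close> may be 0 or negative; this upper bound is
      always a positive divisor.\<close>
    define M where "M = \<bar>H (mat d d g')\<bar> + 1"
    have "m > 0" unfolding m_def by (rule posK[OF g(1)])
    have "M > 0" by (simp add: M_def)
    show ?thesis
    proof (rule that[of "m / M"])
      show "m / M > 0" using \<open>m > 0\<close> \<open>M > 0\<close> by simp
      fix h assume h: "h \<in> K"
      have "m / M * H (mat d d h) \<le> m / M * M"
        using g'[OF h] \<open>m > 0\<close> \<open>M > 0\<close> by (intro mult_left_mono) (auto simp: M_def)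
      also have "\<dots> = m" using \<open>M > 0\<close> by simp
      also have "m \<le> F (mat d d h)" unfolding m_def by (rule g(2)[OF h])
      finally show "m / M * H (mat d d h) \<le> F (mat d d h)" .
    qed
  qed
  show ?thesis
  proof (rule that[OF c(1)])
    fix A assume A: "A \<in> carrier_mat d d" "A \<in> C"
    show "c * H A \<le> F A"
    proof (cases "frobenius_sq A = 0")
      case True
      \<comment> \<open>The zero matrix cannot be normalised, but it is 0 times itself, so
        homogeneity makes \<open>F\<close> and \<open>H\<close> vanish there.\<close>
      have 0: "complex_of_real 0 \<cdot>\<^sub>m A = A" using frobenius_sq_eq_0[OF A(1) True] by auto
      show ?thesis using homF[OF A(1), of 0] homH[OF A(1), of 0] unfolding 0 by simp
    next
      case False
      hence f: "frobenius_sq A > 0" using frobenius_sq_nonneg[of A] by simp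
      define r where "r = 1 / sqrt (frobenius_sq A)"
      have r: "r > 0" "r\<^sup>2 * frobenius_sq A = 1"
        using f by (auto simp: r_def power_divide)
      define B where "B = complex_of_real r \<cdot>\<^sub>m A"
      define g where "g p = (if p \<in> {..<d} \<times> {..<d} then B $$ p else 0)" for p
      have B: "mat d d g = B" using A by (intro eq_matI) (auto simp: g_def B_def)
      have "g \<in> K" unfolding K_def mem_Collect_eq Int_iff B
        using r cone[OF A] by (simp add: B_def frobenius_sq_smult g_def)
      from c(2)[OF this] have "r\<^sup>2 * (c * H A) \<le> r\<^sup>2 * F A"
        unfolding B unfolding B_def homF[OF A(1)] homH[OF A(1)] by (simp add: mult.left_commute)
      thus ?thesis using r(1) by simp
    qed
  qed
qed

context lindblad_steady_state
begin

text \<open>By \<open>solve_tangent\<close>, this contains the solutions \<open>G\<close> for all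
  self-adjoint traceless right-hand sides, the tangent directions to the density operators.\<close>

definition tangent :: "complex mat set" where
  "tangent = {G. mat_adjoint G = G \<and> mat_trace (S * G) = 0}"

lemma closed_tangent: "closed {g. mat d d g \<in> tangent}"
proof -
  have "closed ((\<Inter>i\<in>{..<d}. \<Inter>j\<in>{..<d}. {g :: nat \<times> nat \<Rightarrow> complex. cnj (g (j, i)) = g (i, j)}) \<inter>
      {g. mat_trace (S * mat d d g) = 0})"
    by (intro closed_Int closed_INT ballI closed_Collect_eq continuous_on_cnj
        continuous_on_product_coordinates continuous_on_const continuous_mat_trace[where d = d]
        continuous_mat_mult continuous_mat_const continuous_mat_mat S_carrier mat_carrier
        mult_carrier_mat[OF S_carrier])
  also have "\<dots> = {g. mat d d g \<in> tangent}"
  proof -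
    have "mat_adjoint (mat d d g) = mat d d g \<longleftrightarrow> (\<forall>i<d. \<forall>j<d. cnj (g (j, i)) = g (i, j))" for g
      by (auto simp: mat_eq_iff index_mat_adjoint)
    thus ?thesis by (auto simp: tangent_def)
  qed
  finally show ?thesis .
qed

lemma smult_tangent:
  assumes "G \<in> carrier_mat d d" "G \<in> tangent"
  shows "complex_of_real r \<cdot>\<^sub>m G \<in> tangent"
  using assms mult_smult_distrib[OF S_carrier assms(1)] mat_trace_smult[OF mult_carrier_mat[OF S_carrier assms(1)]]
  by (simp add: tangent_def mat_adjoint_smult)

lemma continuous_diss: "continuous_on UNIV (\<lambda>g. diss (mat d d g))"
proof -
  have *: "continuous_on UNIV (\<lambda>g. mat_trace (S * (mat_adjoint (commutator L (mat d d g)) * commutator L (mat d d g))))"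
    if L: "L \<in> carrier_mat d d" for L
  proof -
    have c: "commutator L (mat d d g) \<in> carrier_mat d d" for g using L by simp
    have "continuous_mat d (\<lambda>g. commutator L (mat d d g))"
      unfolding commutator_def
      by (intro continuous_mat_minus continuous_mat_mult continuous_mat_const continuous_mat_mat L
          mat_carrier mult_carrier_mat[OF L] mult_carrier_mat[OF mat_carrier])
    thus ?thesis
      using c by (intro continuous_mat_trace[where d = d] continuous_mat_mult continuous_mat_const
          continuous_mat_adjoint S_carrier mat_adjoint_carrier mult_carrier_mat[of _ d d _ d])
  qed
  show ?thesis unfolding diss_def
    by (intro continuous_on_add continuous_on_mult continuous_on_const continuous_on_Re * a b)
qed

lemma continuous_energy: "continuous_on UNIV (\<lambda>g. energy (mat d d g))"
  unfolding energy_def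
  by (intro continuous_on_Re continuous_mat_trace[where d = d] continuous_mat_mult continuous_mat_const
      continuous_mat_mat S_carrier mat_carrier mult_carrier_mat[of _ d d _ d])

lemma diss_smult:
  assumes G: "G \<in> carrier_mat d d"
  shows "diss (complex_of_real r \<cdot>\<^sub>m G) = r\<^sup>2 * diss G"
proof -
  have "mat_trace (S * (mat_adjoint (commutator L (complex_of_real r \<cdot>\<^sub>m G)) * commutator L (complex_of_real r \<cdot>\<^sub>m G)))
    = complex_of_real (r\<^sup>2) * mat_trace (S * (mat_adjoint (commutator L G) * commutator L G))"
    if L: "L \<in> carrier_mat d d" for L
  proof -
    define M where "M = commutator L G"
    have M: "M \<in> carrier_mat d d" "mat_adjoint M \<in> carrier_mat d d" using L G by (auto simp: M_def)
    show ?thesis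
      unfolding commutator_linear(2)[OF L G G] mat_adjoint_smult M_def[symmetric]
      using M S_carrier
      by (simp add: mult_smult_distrib[of _ d d _ d] mult_smult_assoc_mat[of _ d d _ d]
          mult_carrier_mat[of _ d d _ d] mat_trace_smult[of _ d] power2_eq_square)
  qed
  from this[OF a] this[OF b] show ?thesis unfolding diss_def by (simp add: algebra_simps)
qed

lemma energy_smult:
  assumes G: "G \<in> carrier_mat d d"
  shows "energy (complex_of_real r \<cdot>\<^sub>m G) = r\<^sup>2 * energy G"
proof -
  have "mat_trace (S * (complex_of_real r \<cdot>\<^sub>m G * (complex_of_real r \<cdot>\<^sub>m G))) =
      complex_of_real (r\<^sup>2) * mat_trace (S * (G * G))"
    using G S_carrier
    by (simp add: mult_smult_distrib[of _ d d _ d] mult_smult_assoc_mat[of _ d d _ d]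
        mult_carrier_mat[of _ d d _ d] mat_trace_smult[of _ d] power2_eq_square)
  thus ?thesis by (simp add: energy_def)
qed

text \<open>A spectral gap estimate; \<open>c\<close> becomes the exponential rate. It cannot extend
  to all self-adjoint \<open>G\<close>, since \<open>diss\<close> vanishes on the identity.\<close>

lemma diss_dominates_energy:
  obtains c where "c > 0" "\<And>G. G \<in> carrier_mat d d \<Longrightarrow> G \<in> tangent \<Longrightarrow> c * energy G \<le> diss G"
proof (rule homogeneous_comparison[OF continuous_diss continuous_energy closed_tangent smult_tangent
      diss_smult energy_smult])
  fix G assume G: "G \<in> carrier_mat d d" "G \<in> tangent" "G \<noteq> 0\<^sub>m d d"
  hence "diss G \<noteq> 0" using diss_eq_0[of G] by (auto simp: tangent_def)
  thus "0 < diss G" using diss_nonneg[OF G(1)] by simp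
qed (assumption | rule that)+

text \<open>Turns decay of the energy into decay of each matrix entry.\<close>

lemma energy_dominates_frobenius_sq:
  obtains c where "c > 0" "\<And>G. G \<in> carrier_mat d d \<Longrightarrow> G \<in> tangent \<Longrightarrow> c * frobenius_sq G \<le> energy G"
proof (rule homogeneous_comparison[OF continuous_energy continuous_frobenius_sq closed_tangent
      smult_tangent energy_smult frobenius_sq_smult])
  fix G assume G: "G \<in> carrier_mat d d" "G \<in> tangent" "G \<noteq> 0\<^sub>m d d"
  hence "energy G \<noteq> 0" using energy_eq_0[of G] by (auto simp: tangent_def)
  thus "0 < energy G" using energy_nonneg[OF G(1)] G(2) by (simp add: tangent_def)
qed (assumption | rule that)+

lemma solve_tangent:
  assumes "X \<in> carrier_mat d d" "mat_adjoint X = X" "mat_trace X = 0"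
  shows "solve X \<in> tangent"
  using assms by (simp add: tangent_def solve_hermitian trace_solve)

lemma solutions_decay:
  assumes X: "\<And>s. s \<ge> 0 \<Longrightarrow> X s \<in> carrier_mat d d"
    and herm: "\<And>s. s \<ge> 0 \<Longrightarrow> mat_adjoint (X s) = X s"
    and trace: "\<And>s. s \<ge> 0 \<Longrightarrow> mat_trace (X s) = 0"
    and deriv: "\<And>s. s \<ge> 0 \<Longrightarrow> has_mat_derivative d X (gen (X s)) s"
    and ij: "i < d" "j < d"
  shows "((\<lambda>t. X t $$ (i, j)) \<longlongrightarrow> 0) at_top"
proof -
  define G where "G t = solve (X t)" for t
  have G: "G t \<in> carrier_mat d d" "G t \<in> tangent" if "t \<ge> 0" for t
    unfolding G_def using that by (auto intro!: solve_carrier solve_tangent X herm trace)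
  obtain c where c: "c > 0" "\<And>G. G \<in> carrier_mat d d \<Longrightarrow> G \<in> tangent \<Longrightarrow> c * energy G \<le> diss G"
    using diss_dominates_energy by blast
  obtain c' where c': "c' > 0"
    "\<And>G. G \<in> carrier_mat d d \<Longrightarrow> G \<in> tangent \<Longrightarrow> c' * frobenius_sq G \<le> energy G"
    using energy_dominates_frobenius_sq by blast
  \<comment> \<open>Gronwall's argument: the exponential weight absorbs the differential inequality
    into a nonincreasing function.\<close>
  have decay: "energy (G t) * exp (c * t) \<le> energy (G 0) * exp (c * 0)" if t: "t \<ge> 0" for t
  proof (rule decreasing_if_derivative_nonpos[OF _ _ t])
    fix s :: real assume s: "s \<ge> 0"
    have "((\<lambda>s. energy (G s)) has_real_derivative - diss (G s)) (at s within {0..})"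
      unfolding G_def by (rule energy_derivative[OF X s herm[OF s] deriv[OF s]])
    thus "((\<lambda>s. energy (G s) * exp (c * s)) has_real_derivative
        (- diss (G s) + c * energy (G s)) * exp (c * s)) (at s within {0..})"
      by (auto intro!: derivative_eq_intros simp: algebra_simps)
    show "(- diss (G s) + c * energy (G s)) * exp (c * s) \<le> 0"
      using c(2)[OF G[OF s]] by (simp add: mult_le_0_iff)
  qed
  have entry: "((\<lambda>t. G t $$ (k, l)) \<longlongrightarrow> 0) at_top" if kl: "k < d" "l < d" for k l
  proof -
    have "((\<lambda>t. energy (G 0) / c' * exp (- (c * t))) \<longlongrightarrow> energy (G 0) / c' * 0) at_top"
      using c(1)
      by (intro tendsto_mult tendsto_const filterlim_compose[OF exp_at_bot]
          filterlim_uminus_at_bot_at_top[THEN filterlim_compose]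
          filterlim_tendsto_pos_mult_at_top[OF tendsto_const] filterlim_ident) auto
    hence lim: "((\<lambda>t. energy (G 0) / c' * exp (- (c * t))) \<longlongrightarrow> 0) at_top" by simp
    have "\<forall>\<^sub>F t in at_top. (cmod (G t $$ (k, l)))\<^sup>2 \<le> energy (G 0) / c' * exp (- (c * t))"
      using eventually_ge_at_top[of 0]
    proof eventually_elim
      case (elim t)
      have "c' * (cmod (G t $$ (k, l)))\<^sup>2 \<le> c' * frobenius_sq (G t)"
        using entry_le_frobenius_sq[OF G(1)[OF elim] kl] c'(1) by simp
      also have "\<dots> \<le> energy (G t)" by (rule c'(2)[OF G[OF elim]])
      also have "\<dots> \<le> energy (G 0) * exp (- (c * t))"
        using decay[OF elim] by (simp add: exp_minus field_simps)
      finally show ?case using c'(1) by (simp add: field_simps)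
    qed
    hence "((\<lambda>t. (cmod (G t $$ (k, l)))\<^sup>2) \<longlongrightarrow> 0) at_top"
      by (rule tendsto_sandwich[OF always_eventually _ tendsto_const lim, rotated]) simp
    hence "((\<lambda>t. cmod (G t $$ (k, l))) \<longlongrightarrow> 0) at_top" by (simp add: power_tendsto_0_iff)
    thus ?thesis by (rule tendsto_norm_zero_cancel)
  qed
  \<comment> \<open>The equation \<open>S G + G S = X\<close> hands the limit from the entries of
    \<open>G\<close> back to those of \<open>X\<close>.\<close>
  have "((\<lambda>t. (\<Sum>l<d. S $$ (i, l) * G t $$ (l, j)) + (\<Sum>l<d. G t $$ (i, l) * S $$ (l, j)))
      \<longlongrightarrow> (\<Sum>l<d. S $$ (i, l) * 0) + (\<Sum>l<d. 0 * S $$ (l, j))) at_top"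
    using ij by (intro tendsto_add tendsto_sum tendsto_mult tendsto_const entry) auto
  moreover have "\<forall>\<^sub>F t in at_top. X t $$ (i, j) =
      (\<Sum>l<d. S $$ (i, l) * G t $$ (l, j)) + (\<Sum>l<d. G t $$ (i, l) * S $$ (l, j))"
    using eventually_ge_at_top[of 0]
  proof eventually_elim
    case (elim t)
    have "X t $$ (i, j) = (S * G t + G t * S) $$ (i, j)"
      unfolding G_def by (simp only: solve_eq[OF X[OF elim]])
    also have "\<dots> = (S * G t) $$ (i, j) + (G t * S) $$ (i, j)"
      using ij carrier_matD[OF G(1)[OF elim]] carrier_matD[OF S_carrier]
      by (simp del: index_mult_mat(1))
    finally show ?case
      by (simp only: index_mult_mat_sum[OF S_carrier G(1)[OF elim] ij]
          index_mult_mat_sum[OF G(1)[OF elim] S_carrier ij])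
  qed
  ultimately show ?thesis by (simp add: tendsto_cong)
qed

end

section \<open>The truncated oscillator\<close>

lemma truncate_carrier: "truncate n A \<in> carrier_mat (n + 1) (n + 1)"
  by (simp add: truncate_def)

declare truncate_carrier[simplified, simp]

lemma smult_truncate_pow:
  "(c \<cdot>\<^sub>m truncate n fock_N) ^\<^sub>m k = mat (n + 1) (n + 1) (\<lambda>(i, j). if i = j then (c * of_nat i) ^ k else 0)"
proof (induction k)
  case 0
  show ?case by (rule eq_matI) (auto simp: truncate_def)
next
  case (Suc k)
  show ?case
  proof (rule eq_matI)
    fix i j assume ij: "i < dim_row (mat (n + 1) (n + 1) (\<lambda>(i, j). if i = j then (c * of_nat i) ^ Suc k else 0))"
      "j < dim_col (mat (n + 1) (n + 1) (\<lambda>(i, j). if i = j then (c * of_nat i) ^ Suc k else 0))"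
    hence ij': "i < n + 1" "j < n + 1" by simp_all
    have "((c \<cdot>\<^sub>m truncate n fock_N) ^\<^sub>m Suc k) $$ (i, j) =
        (\<Sum>l<n + 1. (if i = l then (c * of_nat i) ^ k else 0) * (if l = j then c * of_nat j else 0))"
      unfolding pow_mat.simps Suc.IH
      by (subst index_mult_mat_sum[of _ "n + 1" "n + 1" _ "n + 1"])
        (use ij' in \<open>auto simp: truncate_def fock_N_def intro!: sum.cong\<close>)
    also have "\<dots> = (\<Sum>l<n + 1. if l = i then (if i = j then (c * of_nat i) ^ Suc k else 0) else 0)"
      by (intro sum.cong) auto
    also have "\<dots> = (if i = j then (c * of_nat i) ^ Suc k else 0)"
      using ij' by (simp add: sum.delta)
    finally show "((c \<cdot>\<^sub>m truncate n fock_N) ^\<^sub>m Suc k) $$ (i, j) =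
        mat (n + 1) (n + 1) (\<lambda>(i, j). if i = j then (c * of_nat i) ^ Suc k else 0) $$ (i, j)"
      using ij' by simp
  qed (auto simp: truncate_def)
qed

lemma mat_exp_smult_truncate:
  "mat_exp (c \<cdot>\<^sub>m truncate n fock_N) =
     mat (n + 1) (n + 1) (\<lambda>(i, j). if i = j then exp (c * of_nat i) else 0)"
proof -
  have "(\<Sum>k. z ^ k / fact k) = exp z" for z :: complex
    by (simp add: exp_def scaleR_conv_of_real divide_inverse mult.commute)
  thus ?thesis
    unfolding mat_exp_def smult_truncate_pow
    by (intro eq_matI) (auto simp: truncate_def)
qed

text \<open>The truncation is exact here: \<open>a\<close> lowers the photon number and so maps the
  truncated space into itself, hence no intermediate state is cut off. In the opposite order
  \<open>n + 1\<close> would be lost in the last diagonal entry.\<close>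

lemma fock_a_number: "mat_adjoint (truncate n fock_a) * truncate n fock_a = truncate n fock_N"
proof (rule eq_matI)
  fix i j assume "i < dim_row (truncate n fock_N)" "j < dim_col (truncate n fock_N)"
  hence ij: "i < n + 1" "j < n + 1" by (simp_all add: truncate_def)
  have "(mat_adjoint (truncate n fock_a) * truncate n fock_a) $$ (i, j) =
      (\<Sum>l<n + 1. cnj (fock_a l i) * fock_a l j)"
    by (subst index_mult_mat_sum[of _ "n + 1" "n + 1" _ "n + 1"])
      (use ij in \<open>auto simp: index_mat_adjoint truncate_def\<close>)
  \<comment> \<open>At \<open>i = 0\<close> the difference \<open>i - 1\<close> is 0, but the
    selected value is then 0 as well.\<close>
  also have "\<dots> = (\<Sum>l<n + 1. if l = i - 1 then (if i = j then of_nat j else 0) else 0)"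
  proof (intro sum.cong refl)
    fix l
    show "cnj (fock_a l i) * fock_a l j = (if l = i - 1 then (if i = j then of_nat j else 0) else 0)"
      using of_real_mult[of "sqrt (real j)" "sqrt (real j)", where 'a = complex, symmetric]
      by (cases "i = 0") (auto simp: fock_a_def)
  qed
  also have "\<dots> = truncate n fock_N $$ (i, j)"
    using ij by (auto simp: truncate_def fock_N_def)
  finally show "(mat_adjoint (truncate n fock_a) * truncate n fock_a) $$ (i, j) = truncate n fock_N $$ (i, j)" .
qed (auto simp: truncate_def)

text \<open>\<open>E\<close> is unitary, so \<open>a\<close> and \<open>E a\<close> have the same
  number operator \<open>N\<close>, and one anticommutator with \<open>N\<close> of weight
  \<open>(\<kappa> + \<kappa>\<^sub>c) / 2\<close> serves both dissipators. Subtracting the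
  \<open>\<kappa>\<^sub>c\<close> term leaves the jump \<open>a\<close> with rate
  \<open>\<kappa>\<close> and gives \<open>E a\<close> rate \<open>\<kappa>\<^sub>c\<close>.\<close>

lemma master_rhs_lindbladian:
  fixes n :: nat and \<beta> \<kappa> \<kappa>\<^sub>c :: real
  defines "a \<equiv> truncate n fock_a"
    and "E \<equiv> mat_exp ((\<i> * complex_of_real pi) \<cdot>\<^sub>m truncate n fock_N)"
  assumes \<rho>: "\<rho> \<in> carrier_mat (n + 1) (n + 1)"
  shows "master_rhs n \<beta> \<kappa> \<kappa>\<^sub>c \<rho> =
    lindbladian (complex_of_real \<beta> \<cdot>\<^sub>m (mat_adjoint a - a)) \<kappa> a \<kappa>\<^sub>c (E * a) \<rho>"
    and "E \<in> carrier_mat (n + 1) (n + 1)"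
proof -
  define d where "d = n + 1"
  define a' where "a' = mat_adjoint a"
  define N where "N = truncate n fock_N"
  define E' where "E' = mat_exp ((- \<i> * complex_of_real pi) \<cdot>\<^sub>m truncate n fock_N)"
  have a: "a \<in> carrier_mat d d" "a' \<in> carrier_mat d d" and N: "N \<in> carrier_mat d d"
    and \<rho>: "\<rho> \<in> carrier_mat d d"
    using \<rho> by (simp_all add: a_def a'_def N_def d_def)
  have E: "E \<in> carrier_mat d d" and E': "E' \<in> carrier_mat d d"
    unfolding E_def E'_def mat_exp_smult_truncate d_def by simp_all
  show "E \<in> carrier_mat (n + 1) (n + 1)" using E by (simp add: d_def)
  have "cnj (exp (\<i> * complex_of_real pi * of_nat m)) = exp (- \<i> * complex_of_real pi * of_nat m)" for m
    using cis_cnj[of "pi * real m"] by (simp add: cis_conv_exp mult.assoc)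
  hence adj: "mat_adjoint E = E'"
    unfolding E_def E'_def mat_exp_smult_truncate
    by (intro eq_matI) (auto simp: index_mat_adjoint)
  have unitary: "E' * E = 1\<^sub>m d"
  proof (rule eq_matI)
    fix i j assume "i < dim_row (1\<^sub>m d :: complex mat)" "j < dim_col (1\<^sub>m d :: complex mat)"
    hence ij: "i < d" "j < d" by simp_all
    have "(E' * E) $$ (i, j) = (\<Sum>l<d. E' $$ (i, l) * E $$ (l, j))"
      by (rule index_mult_mat_sum[OF E' E ij])
    also have "\<dots> = (\<Sum>l<d. if l = i then (if i = j then 1 else 0) else 0)"
    proof (intro sum.cong refl)
      fix l assume "l \<in> {..<d}"
      thus "E' $$ (i, l) * E $$ (l, j) = (if l = i then (if i = j then 1 else 0) else 0)"
        using ij unfolding E_def E'_def mat_exp_smult_truncate d_def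
        by (auto simp: exp_add[symmetric])
    qed
    finally show "(E' * E) $$ (i, j) = 1\<^sub>m d $$ (i, j)" using ij by simp
  qed (use E E' in auto)
  have Ea: "mat_adjoint (E * a) = a' * E'"
    unfolding mat_adjoint_mult[OF E a(1)] adj a'_def ..
  have EaEa: "(a' * E') * (E * a) = N"
  proof -
    have "(a' * E') * (E * a) = a' * ((E' * E) * a)"
      using a E E' by (simp add: square_mat_simps[where d = d])
    also have "\<dots> = N"
      unfolding unitary left_mult_one_mat[OF a(1)] by (simp add: N_def a'_def a_def fock_a_number)
    finally show ?thesis .
  qed
  have aa: "a' * a = N" by (simp add: N_def a'_def a_def fock_a_number)
  have "master_rhs n \<beta> \<kappa> \<kappa>\<^sub>c \<rho> = complex_of_real \<beta> \<cdot>\<^sub>m commutator (a' - a) \<rho>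
      - complex_of_real ((\<kappa> + \<kappa>\<^sub>c) / 2) \<cdot>\<^sub>m (N * \<rho> + \<rho> * N - 2 \<cdot>\<^sub>m (a * \<rho> * a'))
      - complex_of_real \<kappa>\<^sub>c \<cdot>\<^sub>m (a * \<rho> * a' - E * a * \<rho> * a' * E')"
    unfolding master_rhs_def Let_def N_def a'_def a_def E_def E'_def ..
  also have "\<dots> = lindbladian (complex_of_real \<beta> \<cdot>\<^sub>m (a' - a)) \<kappa> a \<kappa>\<^sub>c (E * a) \<rho>"
    unfolding lindbladian_def dissipator_def commutator_def Ea EaEa a'_def[symmetric] aa
    by (rule eq_matI; use a N \<rho> E E' in \<open>simp add: square_mat_simps[where d = d] ring_distribs
      add_divide_distrib diff_divide_distrib del: index_mult_mat(1)\<close>)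
  finally show "master_rhs n \<beta> \<kappa> \<kappa>\<^sub>c \<rho> =
      lindbladian (complex_of_real \<beta> \<cdot>\<^sub>m (mat_adjoint a - a)) \<kappa> a \<kappa>\<^sub>c (E * a) \<rho>"
    unfolding a'_def .
qed

text \<open>Commutation links entries along each diagonal. Strictly below the main diagonal the
  chain starts at column 0, where it forces 0; on it the weights coincide and the entries are equal.
  Self-adjointness clears the upper half.\<close>

lemma commutes_with_fock_a:
  assumes G: "G \<in> carrier_mat (n + 1) (n + 1)" and herm: "mat_adjoint G = G"
    and comm: "commutator (truncate n fock_a) G = 0\<^sub>m (n + 1) (n + 1)"
  shows "\<exists>c. G = c \<cdot>\<^sub>m 1\<^sub>m (n + 1)"
proof -
  let ?a = "truncate n fock_a"
  \<comment> \<open>The bound \<open>i < n\<close> is sharp: row \<open>n\<close> of the truncated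
    \<open>a\<close> is zero, and there is no row \<open>Suc n\<close> of \<open>G\<close>.\<close>
  have left: "(?a * G) $$ (i, j) = complex_of_real (sqrt (real (Suc i))) * G $$ (Suc i, j)"
    if "i < n" "j < n + 1" for i j
  proof -
    have "(?a * G) $$ (i, j) = (\<Sum>l<n + 1. ?a $$ (i, l) * G $$ (l, j))"
      by (rule index_mult_mat_sum[OF truncate_carrier G]) (use that in auto)
    also have "\<dots> = (\<Sum>l<n + 1. if l = Suc i then complex_of_real (sqrt (real (Suc i))) * G $$ (Suc i, j) else 0)"
      using that by (intro sum.cong) (auto simp: truncate_def fock_a_def)
    finally show ?thesis using that by (simp add: sum.delta)
  qed
  have right: "(G * ?a) $$ (i, j) = (if j = 0 then 0 else complex_of_real (sqrt (real j)) * G $$ (i, j - 1))"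
    if "i < n + 1" "j < n + 1" for i j
  proof -
    have "(G * ?a) $$ (i, j) = (\<Sum>l<n + 1. G $$ (i, l) * ?a $$ (l, j))"
      by (rule index_mult_mat_sum[OF G truncate_carrier]) (use that in auto)
    also have "\<dots> = (\<Sum>l<n + 1. if l = j - 1 then
        (if j = 0 then 0 else complex_of_real (sqrt (real j)) * G $$ (i, j - 1)) else 0)"
      using that by (intro sum.cong) (auto simp: truncate_def fock_a_def)
    finally show ?thesis using that by (simp add: sum.delta less_imp_diff_less del: sum.lessThan_Suc)
  qed
  have step: "complex_of_real (sqrt (real (Suc i))) * G $$ (Suc i, j) =
      (if j = 0 then 0 else complex_of_real (sqrt (real j)) * G $$ (i, j - 1))"
    if ij: "i < n" "j < n + 1" for i j
  proof -
    have "(?a * G - G * ?a) $$ (i, j) = 0" using comm ij by (simp add: commutator_def)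
    moreover have "(?a * G - G * ?a) $$ (i, j) = (?a * G) $$ (i, j) - (G * ?a) $$ (i, j)"
      using G ij carrier_matD[OF truncate_carrier[of n fock_a]] by (simp del: index_mult_mat(1))
    ultimately show ?thesis using left[OF ij] right[of i j] ij by simp
  qed
  have below: "G $$ (i, j) = 0" if "j < i" "i < n + 1" for i j
    using that
  proof (induction j arbitrary: i)
    case 0
    then obtain i' where "i = Suc i'" by (cases i) auto
    thus ?case using step[of i' 0] 0 by simp
  next
    case (Suc j)
    then obtain i' where i': "i = Suc i'" by (cases i) auto
    hence "G $$ (i', j) = 0" using Suc by simp
    thus ?case using step[of i' "Suc j"] Suc.prems i' by simp
  qed
  have above: "G $$ (i, j) = 0" if "i < j" "j < n + 1" for i j
  proof -
    have "mat_adjoint G $$ (i, j) = cnj (G $$ (j, i))"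
      using that G by (subst index_mat_adjoint) auto
    thus ?thesis using below[OF that] herm by simp
  qed
  have diag: "G $$ (i, i) = G $$ (0, 0)" if "i < n + 1" for i
    using that
  proof (induction i)
    case (Suc i)
    thus ?case using step[of i "Suc i"] by simp
  qed simp
  have "G = G $$ (0, 0) \<cdot>\<^sub>m 1\<^sub>m (n + 1)"
  proof (rule eq_matI)
    fix i j assume "i < dim_row (G $$ (0, 0) \<cdot>\<^sub>m 1\<^sub>m (n + 1))" "j < dim_col (G $$ (0, 0) \<cdot>\<^sub>m 1\<^sub>m (n + 1))"
    hence "i < n + 1" "j < n + 1" by simp_all
    thus "G $$ (i, j) = (G $$ (0, 0) \<cdot>\<^sub>m 1\<^sub>m (n + 1)) $$ (i, j)"
      using below[of j i] above[of i j] diag[of i] by (cases i j rule: linorder_cases) auto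
  qed (use G in auto)
  thus ?thesis by blast
qed

section \<open>Strict Lyapunov property and global convergence\<close>

theorem propositionV4:
  fixes n :: nat and \<beta> \<kappa> \<kappa>\<^sub>c :: real and \<sigma> :: "complex mat"
  assumes "n > 0" and "\<kappa> > 0" and "\<kappa>\<^sub>c \<ge> 0"
    and "full_rank_steady_state n \<beta> \<kappa> \<kappa>\<^sub>c \<sigma>"
  shows "strict_lyapunov (density_operators (n + 1)) (master_solution n \<beta> \<kappa> \<kappa>\<^sub>c) (V_Bures \<sigma>) \<sigma> \<and>
         (\<forall>\<rho>. master_solution n \<beta> \<kappa> \<kappa>\<^sub>c \<rho> \<longrightarrow>
           (\<forall>i\<le>n. \<forall>j\<le>n. ((\<lambda>t. \<rho> t $$ (i, j)) \<longlongrightarrow> \<sigma> $$ (i, j)) at_top))"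
proof -
  define d where "d = n + 1"
  define a where "a = truncate n fock_a"
  define E where "E = mat_exp ((\<i> * complex_of_real pi) \<cdot>\<^sub>m truncate n fock_N)"
  define A where "A = complex_of_real \<beta> \<cdot>\<^sub>m (mat_adjoint a - a)"
  have a: "a \<in> carrier_mat d d" by (simp add: a_def d_def)
  have E: "E \<in> carrier_mat d d"
    unfolding E_def d_def by (rule master_rhs_lindbladian(2)[OF zero_carrier_mat])
  have rhs: "master_rhs n \<beta> \<kappa> \<kappa>\<^sub>c X = lindbladian A \<kappa> a \<kappa>\<^sub>c (E * a) X" if "X \<in> carrier_mat d d" for X
    unfolding A_def a_def E_def by (rule master_rhs_lindbladian(1)[OF that[unfolded d_def]])
  have \<sigma>: "\<sigma> \<in> carrier_mat d d" "mat_adjoint \<sigma> = \<sigma>" "mat_trace \<sigma> = 1"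
    "\<And>v. v \<in> carrier_vec d \<Longrightarrow> 0 \<le> (\<sigma> *\<^sub>v v) \<bullet>c v" and "vec_space.rank d \<sigma> = d"
    and steady: "master_rhs n \<beta> \<kappa> \<kappa>\<^sub>c \<sigma> = 0\<^sub>m d d"
    using assms(4) by (auto simp: full_rank_steady_state_def density_operators_def d_def)
  have "det \<sigma> \<noteq> 0" using \<open>vec_space.rank d \<sigma> = d\<close> vec_space.det_rank_iff[OF \<sigma>(1)] by simp
  interpret lindblad_steady_state d A \<kappa> a \<kappa>\<^sub>c "E * a" \<sigma>
  proof
    show "A \<in> carrier_mat d d" unfolding A_def by (rule smult_carrier_mat[OF minus_carrier_mat[OF a]])
    show "mat_adjoint A = - A"
      unfolding A_def using a by (intro eq_matI) (auto simp: index_mat_adjoint algebra_simps)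
    show "a \<in> carrier_mat d d" by (rule a)
    show "E * a \<in> carrier_mat d d" by (rule mult_carrier_mat[OF E a])
    show "positive_definite d \<sigma>" by (rule positive_definiteI[OF \<sigma>(1,2,4) \<open>det \<sigma> \<noteq> 0\<close>])
    show "lindbladian A \<kappa> a \<kappa>\<^sub>c (E * a) \<sigma> = 0\<^sub>m d d" using steady rhs[OF \<sigma>(1)] by simp
    show "\<exists>c. G = c \<cdot>\<^sub>m 1\<^sub>m d"
      if "G \<in> carrier_mat d d" "mat_adjoint G = G" "commutator a G = 0\<^sub>m d d" for G
      using that commutes_with_fock_a unfolding a_def d_def by blast
  qed (use assms \<sigma> in auto)
  have V: "V_Bures \<sigma> \<rho> = energy (solve (\<rho> - \<sigma>))" for \<rho>
    by (simp add: carrier_matD[OF \<sigma>(1)] V_Bures_def bures_G_def energy_def solve_def)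
  have minus_eq_0: "\<rho> - \<sigma> = 0\<^sub>m d d \<longleftrightarrow> \<rho> = \<sigma>" if "\<rho> \<in> carrier_mat d d" for \<rho>
    using that \<sigma>(1) by (auto simp: mat_eq_iff)
  have minus_hermitian: "mat_adjoint (\<rho> - \<sigma>) = \<rho> - \<sigma>"
    if "\<rho> \<in> carrier_mat d d" "mat_adjoint \<rho> = \<rho>" for \<rho>
    unfolding mat_adjoint_minus[OF that(1) \<sigma>(1)] that(2) \<sigma>(2) ..
  \<comment> \<open>A difference of matrices takes its dimensions from the subtrahend, so this
    covers the values of a solution at negative times too.\<close>
  have minus_carrier: "\<rho> - \<sigma> \<in> carrier_mat d d" for \<rho> by (rule minus_carrier_mat[OF \<sigma>(1)])
  have state: "0 \<le> V_Bures \<sigma> \<rho>" "V_Bures \<sigma> \<rho> = 0 \<longleftrightarrow> \<rho> = \<sigma>" if "\<rho> \<in> density_operators (n + 1)" for \<rho>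
  proof -
    have \<rho>: "\<rho> \<in> carrier_mat d d" "mat_adjoint \<rho> = \<rho>"
      using that by (auto simp: density_operators_def d_def)
    define G where "G = solve (\<rho> - \<sigma>)"
    have G: "G \<in> carrier_mat d d" "mat_adjoint G = G"
      unfolding G_def by (rule solve_carrier[OF minus_carrier],
        rule solve_hermitian[OF minus_carrier minus_hermitian[OF \<rho>]])
    show "0 \<le> V_Bures \<sigma> \<rho>" unfolding V G_def[symmetric] by (rule energy_nonneg[OF G])
    have "energy G = 0 \<longleftrightarrow> G = 0\<^sub>m d d"
    proof
      show "energy G = 0" if "G = 0\<^sub>m d d"
        unfolding that energy_def using right_mult_zero_mat[OF \<sigma>(1)] by (simp add: mat_trace_def)
    qed (rule energy_eq_0[OF G])
    thus "V_Bures \<sigma> \<rho> = 0 \<longleftrightarrow> \<rho> = \<sigma>"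
      unfolding V G_def solve_eq_0_iff[OF minus_carrier] minus_eq_0[OF \<rho>(1)] .
  qed
  have flow: "(\<forall>t\<ge>0. \<exists>D. ((\<lambda>s. V_Bures \<sigma> (\<rho> s)) has_real_derivative D) (at t within {0..}) \<and>
        D \<le> 0 \<and> (D = 0 \<longleftrightarrow> \<rho> t = \<sigma>)) \<and>
      (\<forall>i\<le>n. \<forall>j\<le>n. ((\<lambda>t. \<rho> t $$ (i, j)) \<longlongrightarrow> \<sigma> $$ (i, j)) at_top)"
    if "master_solution n \<beta> \<kappa> \<kappa>\<^sub>c \<rho>" for \<rho>
  proof -
    have init: "mat_adjoint (\<rho> 0) = \<rho> 0" "mat_trace (\<rho> 0) = 1"
      and \<rho>: "\<And>t. t \<ge> 0 \<Longrightarrow> \<rho> t \<in> carrier_mat d d"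
      and ode: "\<And>t i j. t \<ge> 0 \<Longrightarrow> i \<le> n \<Longrightarrow> j \<le> n \<Longrightarrow> ((\<lambda>s. \<rho> s $$ (i, j)) has_vector_derivative
          master_rhs n \<beta> \<kappa> \<kappa>\<^sub>c (\<rho> t) $$ (i, j)) (at t within {0..})"
      using that by (auto simp: master_solution_def density_operators_def d_def)
    have deriv: "has_mat_derivative d \<rho> (gen (\<rho> t)) t" if "t \<ge> 0" for t
      using ode[OF that] unfolding has_mat_derivative_def rhs[OF \<rho>[OF that], symmetric]
      by (simp add: d_def)
    define X where "X t = \<rho> t - \<sigma>" for t
    have X: "X t \<in> carrier_mat d d" for t unfolding X_def by (rule minus_carrier)
    have herm: "mat_adjoint (X t) = X t" if "t \<ge> 0" for t
      unfolding X_def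
      by (rule minus_hermitian[OF \<rho>[OF that] hermitian_preserved[OF \<rho> deriv init(1) that]])
    have trace: "mat_trace (X t) = 0" if "t \<ge> 0" for t
      unfolding X_def mat_trace_minus[OF \<rho>[OF that] \<sigma>(1)]
      using trace_preserved[OF \<rho> deriv that] init(2) \<sigma>(3) by simp
    \<comment> \<open>The generator is linear and annihilates \<open>\<sigma>\<close>, so the
      deviation from \<open>\<sigma>\<close> obeys the same equation.\<close>
    have X': "has_mat_derivative d X (gen (X t)) t" if "t \<ge> 0" for t
    proof -
      have "gen (X t) = gen (\<rho> t) - 0\<^sub>m d d"
        unfolding X_def gen_linear(1)[OF \<rho>[OF that] \<sigma>(1)] local.steady ..
      moreover have "X s $$ (i, j) = \<rho> s $$ (i, j) - \<sigma> $$ (i, j)" if "i < d" "j < d" for s i j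
        using that by (simp add: carrier_matD[OF \<sigma>(1)] X_def)
      moreover have "((\<lambda>s. \<rho> s $$ (i, j) - \<sigma> $$ (i, j)) has_vector_derivative gen (\<rho> t) $$ (i, j) - 0)
          (at t within {0..})" if "i < d" "j < d" for i j
        using deriv[OF \<open>t \<ge> 0\<close>] that unfolding has_mat_derivative_def
        by (intro has_vector_derivative_diff has_vector_derivative_const) auto
      ultimately show ?thesis unfolding has_mat_derivative_def by simp
    qed
    show ?thesis
    proof (intro conjI allI impI)
      fix t :: real assume t: "t \<ge> 0"
      define G where "G = solve (X t)"
      have G: "G \<in> carrier_mat d d" "mat_adjoint G = G" "mat_trace (\<sigma> * G) = 0"
        unfolding G_def
        by (rule solve_carrier[OF X], rule solve_hermitian[OF X herm[OF t]])
          (simp add: trace_solve[OF X] trace[OF t])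
      have "diss G = 0 \<longleftrightarrow> G = 0\<^sub>m d d"
      proof
        assume "G = 0\<^sub>m d d"
        thus "diss G = 0" using diss_smult[OF G(1), of 0] by simp
      qed (rule diss_eq_0[OF G])
      hence "- diss G = 0 \<longleftrightarrow> \<rho> t = \<sigma>"
        using solve_eq_0_iff[OF X] minus_eq_0[OF \<rho>[OF t]] by (simp add: G_def X_def)
      moreover have "((\<lambda>s. V_Bures \<sigma> (\<rho> s)) has_real_derivative - diss G) (at t within {0..})"
        unfolding V G_def X_def[symmetric] by (rule energy_derivative[OF X t herm[OF t] X'[OF t]])
      moreover have "- diss G \<le> 0" using diss_nonneg[OF G(1)] by simp
      ultimately show "\<exists>D. ((\<lambda>s. V_Bures \<sigma> (\<rho> s)) has_real_derivative D) (at t within {0..}) \<and>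
          D \<le> 0 \<and> (D = 0 \<longleftrightarrow> \<rho> t = \<sigma>)" by blast
    next
      fix i j assume "i \<le> n" "j \<le> n"
      hence ij: "i < d" "j < d" by (simp_all add: d_def)
      have "((\<lambda>t. X t $$ (i, j) + \<sigma> $$ (i, j)) \<longlongrightarrow> 0 + \<sigma> $$ (i, j)) at_top"
        by (intro tendsto_add tendsto_const solutions_decay[OF X herm trace X' ij])
      moreover have "X t $$ (i, j) + \<sigma> $$ (i, j) = \<rho> t $$ (i, j)" for t
        using ij by (simp add: carrier_matD[OF \<sigma>(1)] X_def)
      ultimately show "((\<lambda>t. \<rho> t $$ (i, j)) \<longlongrightarrow> \<sigma> $$ (i, j)) at_top" by simp
    qed
  qed
  show ?thesis unfolding strict_lyapunov_def using state flow by blast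
qed

end
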